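(* The inverse, $\hat{\boldsymbol S}_{\rm RB}^{-1}$, of the Rao-Blackwell estimator, $\hat{\boldsymbol S}_{\rm RB}$, of the spectral matrix $\boldsymbol S$ is in the form of a "Rao-Blackwellized" estimator for the precision matrix $\boldsymbol C=\boldsymbol S^{-1}$.
   Context: $\boldsymbol S$ is the unknown $p\times p$ complex Hermitian spectral matrix, at a fixed frequency (suppressed in the notation), of a stationary real $p$-vector-valued time series, and $\boldsymbol C=\boldsymbol S^{-1}$ is its inverse (the precision matrix). The data $\boldsymbol J_0,\ldots,\boldsymbol J_{K-1}$ ($K$ tapered vector Fourier transforms of the series at that frequency) are taken to be independent and identically distributed as $p$-vector-valued complex Gaussian with mean zero and covariance matrix $\boldsymbol S$, so that their joint probability density is $\pi^{-pK}\det^K\{\boldsymbol C\}\exp[-K\,\mathrm{tr}\{\boldsymbol C\hat{\boldsymbol S}\}]$, where $\hat{\boldsymbol S}=\frac1K\sum_{k=0}^{K-1}\hat{\boldsymbol S}_k$ and $\hat{\boldsymbol S}_k=\boldsymbol J_k\boldsymbol J_k^H$. Here $^H$ is conjugate transpose, $\mathrm{tr}$ is the trace, $\mathrm{tr}^2\{\boldsymbol A\}=(\mathrm{tr}\{\boldsymbol A\})^2$, $\|\boldsymbol A\|_{\rm F}=[\mathrm{tr}\{\boldsymbol A\boldsymbol A^H\}]^{1/2}$, and $\boldsymbol I_p$ is the $p\times p$ identity. Both $K<p$ (where $\hat{\boldsymbol S}$ is singular) and $K\ge p$ are allowed. With $\hat\mu_0=\mathrm{tr}\{\hat{\boldsymbol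 S}\}/p$, the Ledoit-Wolf estimator of $\boldsymbol S$ is $\hat{\boldsymbol S}_{\rm LW}=[1-\hat\rho_{\rm LW}]\hat{\boldsymbol S}+\hat\rho_{\rm LW}\hat\mu_0\boldsymbol I_p$, where $$\hat\rho_{\rm LW}=\frac{\sum_{k=0}^{K-1}\|\hat{\boldsymbol S}_k-\hat{\boldsymbol S}\|_{\rm F}^2}{K^2\left[\mathrm{tr}\{\hat{\boldsymbol S}^2\}-(\mathrm{tr}^2\{\hat{\boldsymbol S}\}/p)\right]}.$$ The Rao-Blackwell estimator of $\boldsymbol S$ is $\hat{\boldsymbol S}_{\rm RB}=E\{\hat{\boldsymbol S}_{\rm LW}\mid\hat{\boldsymbol S}\}=[1-\hat\rho_{\rm RB}]\hat{\boldsymbol S}+\hat\rho_{\rm RB}\hat\mu_0\boldsymbol I_p$, with $\hat\rho_{\rm RB}=E\{\hat\rho_{\rm LW}\mid\hat{\boldsymbol S}\}$. A Rao-Blackwell (or "Rao-Blackwellized") estimator of a parameter is the conditional expectation $E\{\mathcal S(\boldsymbol J_0,\ldots,\boldsymbol J_{K-1})\mid T\}$ of an estimator $\mathcal S(\boldsymbol J_0,\ldots,\boldsymbol J_{K-1})$ of that parameter, given a statistic $T=T(\boldsymbol J_0,\ldots,\boldsymbol J_{K-1})$ that is sufficient for the parameter. *)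

theory Defs
  imports "HOL-Probability.Probability"
begin

section \<open>Complex matrices\<close>

definition ctranspose :: "complex^'n^'m \<Rightarrow> complex^'m^'n"
  where "ctranspose A = (\<chi> i j. cnj (A $ j $ i))"

definition frobenius_norm :: "complex^'n^'n \<Rightarrow> real"
  where "frobenius_norm A = sqrt (Re (trace (A ** ctranspose A)))"

definition quad_form :: "complex^'n^'n \<Rightarrow> complex^'n \<Rightarrow> complex"
  where "quad_form A z = (\<Sum>i\<in>UNIV. \<Sum>j\<in>UNIV. cnj (z $ i) * A $ i $ j * z $ j)"

definition hermitian_pos_def :: "complex^'n^'n \<Rightarrow> bool"
  where "hermitian_pos_def A \<longleftrightarrow>
    ctranspose A = A \<and> (\<forall>z. z \<noteq> 0 \<longrightarrow> 0 < Re (quad_form A z))"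


section \<open>Conditional expectation, sufficiency and Rao-Blackwellization\<close>

definition sigma_of :: "'a measure \<Rightarrow> ('a \<Rightarrow> 't::topological_space) \<Rightarrow> 'a measure"
  where "sigma_of M T = vimage_algebra (space M) T borel"

definition matrix_cond_exp ::
  "'a measure \<Rightarrow> 'a measure \<Rightarrow> ('a \<Rightarrow> complex^'n^'m) \<Rightarrow> 'a \<Rightarrow> complex^'n^'m"
  where "matrix_cond_exp M F X \<omega> =
    (\<chi> i j. Complex (real_cond_exp M F (\<lambda>w. Re (X w $ i $ j)) \<omega>)
                    (real_cond_exp M F (\<lambda>w. Im (X w $ i $ j)) \<omega>))"

text \<open>
  \<open>Y\<close> is a version of \<open>E(X | T)\<close> under every member \<open>P \<theta>\<close> of the statistical model.
  Neither \<open>X\<close> nor \<open>Y\<close> may depend on the parameter \<open>\<theta>\<close>.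

  The conditional expectation is taken in the extended sense: \<open>X\<close> need not be integrable, but
  \<open>E(norm X | T)\<close> must be finite almost surely (for integrable \<open>X\<close> this is automatic), so
  that \<^const>\<open>real_cond_exp\<close>, the difference of the conditional expectations of the positive
  and the negative part, is the difference of two finite quantities. The extended sense is needed:
  the untruncated shrinkage intensity below may exceed 1, and the inverse of the shrinkage estimator
  then has entries with infinite first absolute moment (already when there are at least as many
  observations as dimensions).
\<close>

definition cond_exp_given ::
  "'p set \<Rightarrow> ('p \<Rightarrow> 'a measure) \<Rightarrow> ('a \<Rightarrow> complex^'n^'m) \<Rightarrow> ('a \<Rightarrow> 't::topological_space)
     \<Rightarrow> ('a \<Rightarrow> complex^'n^'m) \<Rightarrow> bool"
  where "cond_exp_given \<Theta> P X T Y \<longleftrightarrow>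
    (\<forall>\<theta>\<in>\<Theta>.
        T \<in> borel_measurable (P \<theta>) \<and>
        X \<in> borel_measurable (P \<theta>) \<and>
        Y \<in> borel_measurable (sigma_of (P \<theta>) T) \<and>
        (AE \<omega> in P \<theta>. nn_cond_exp (P \<theta>) (sigma_of (P \<theta>) T) (\<lambda>w. ennreal (norm (X w))) \<omega> < \<infinity>) \<and>
        (AE \<omega> in P \<theta>. Y \<omega> = matrix_cond_exp (P \<theta>) (sigma_of (P \<theta>) T) X \<omega>))"

text \<open>
  Sufficiency in the sense of Halmos and Savage: the conditional probability of every event given
  \<open>T\<close> has a version, as a function of the value of \<open>T\<close>, that is common to all parameters.
\<close>

definition sufficient_for ::
  "'p set \<Rightarrow> ('p \<Rightarrow> 'a measure) \<Rightarrow> ('a \<Rightarrow> 't::topological_space) \<Rightarrow> bool"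
  where "sufficient_for \<Theta> P T \<longleftrightarrow>
    (\<forall>\<theta>\<in>\<Theta>. T \<in> borel_measurable (P \<theta>)) \<and>
    (\<forall>A. (\<forall>\<theta>\<in>\<Theta>. A \<in> sets (P \<theta>)) \<longrightarrow>
      (\<exists>g :: 't \<Rightarrow> real. g \<in> borel_measurable borel \<and>
        (\<forall>\<theta>\<in>\<Theta>. AE \<omega> in P \<theta>.
           real_cond_exp (P \<theta>) (sigma_of (P \<theta>) T) (indicat_real A) \<omega> = g (T \<omega>))))"

text \<open>
  The conditioning statistic is an explicit argument: with it existentially quantified the notion
  would be trivial, since the full data are always sufficient.
\<close>

definition rao_blackwellized_given ::
  "'p set \<Rightarrow> ('p \<Rightarrow> 'a measure) \<Rightarrow> ('a \<Rightarrow> 't::topological_space) \<Rightarrow> ('a \<Rightarrow> complex^'n^'m) \<Rightarrow> bool"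
  where "rao_blackwellized_given \<Theta> P T Y \<longleftrightarrow>
    sufficient_for \<Theta> P T \<and> (\<exists>X. cond_exp_given \<Theta> P X T Y)"


section \<open>The complex Gaussian model\<close>

definition cgauss_density :: "complex^'p^'p \<Rightarrow> complex^'p \<Rightarrow> real"
  where "cgauss_density S z =
    exp (- Re (quad_form (matrix_inv S) z)) / (pi ^ CARD('p) * Re (det S))"

text \<open>
  A data point \<open>J\<close> consists of the \<open>K = CARD('k)\<close> vectors \<open>J $ k\<close>, which under the model with
  covariance matrix \<open>S\<close> are independent with density \<^const>\<open>cgauss_density\<close> \<open>S\<close>.
\<close>

definition gauss_model :: "complex^'p^'p \<Rightarrow> (complex^'p^'k) measure"
  where "gauss_model S = density lborel (\<lambda>J. ennreal (\<Prod>k\<in>UNIV. cgauss_density S (J $ k)))"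


section \<open>Shrinkage estimators\<close>

definition periodogram :: "complex^'p^'k \<Rightarrow> 'k \<Rightarrow> complex^'p^'p"
  where "periodogram J k = (\<chi> i j. J $ k $ i * cnj (J $ k $ j))"

definition S_hat :: "complex^'p^'k \<Rightarrow> complex^'p^'p"
  where "S_hat J = (1 / real CARD('k)) *\<^sub>R (\<Sum>k\<in>UNIV. periodogram J k)"

definition mu_hat :: "complex^'p^'k \<Rightarrow> real"
  where "mu_hat J = Re (trace (S_hat J)) / real CARD('p)"

definition rho_LW :: "complex^'p^'k \<Rightarrow> real"
  where "rho_LW J =
    (\<Sum>k\<in>UNIV. (frobenius_norm (periodogram J k - S_hat J))\<^sup>2) /
    ((real CARD('k))\<^sup>2 *
       (Re (trace (S_hat J ** S_hat J)) - (Re (trace (S_hat J)))\<^sup>2 / real CARD('p)))"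

definition S_LW :: "complex^'p^'k \<Rightarrow> complex^'p^'p"
  where "S_LW J = (1 - rho_LW J) *\<^sub>R S_hat J + (rho_LW J * mu_hat J) *\<^sub>R mat 1"

definition rao_blackwell_estimator :: "(complex^'p^'k \<Rightarrow> complex^'p^'p) \<Rightarrow> bool"
  where "rao_blackwell_estimator S_RB \<longleftrightarrow>
    cond_exp_given {S. hermitian_pos_def S} gauss_model S_LW S_hat S_RB"

end

theory Submission
  imports Defs
begin

text \<open>
  Write \<open>K\<close> for the number of observations, \<open>t = tr S\<close> and \<open>q = tr S\<^sup>2\<close> with \<open>S\<close> the sample
  matrix. The only part of the Ledoit-Wolf intensity that is not a function of \<open>S\<close> is the fourth
  moment \<open>\<Sum>k. \<parallel>J\<^sub>k\<parallel>\<^sup>4\<close>. Replacing a pair \<open>(J\<^sub>k, J\<^sub>l)\<close> by \<open>(J\<^sub>k \<plusminus> c J\<^sub>l) / \<surd>2\<close> with \<open>c \<in> {1, \<i>}\<close>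
  preserves \<open>S\<close> and every Gaussian measure of the model, and the sum of the changes of the fourth
  moment over all these rotations expresses it through \<open>t\<^sup>2 + q\<close>. Hence
  \<open>E(\<Sum>k. \<parallel>J\<^sub>k\<parallel>\<^sup>4 | S) = K\<^sup>2 (t\<^sup>2 + q) / (K + 1)\<close>, which gives the Rao-Blackwell estimator in closed form.
  Its determinant, multiplied by powers of the denominator of the intensity, is a polynomial in the
  data. It does not vanish at data of rank one, where the intensity lies strictly between 0 and 1,
  so the estimator is almost surely invertible. Its inverse is a function of \<open>S\<close>, hence its own
  conditional expectation given \<open>S\<close>, and \<open>S\<close> is sufficient because the densities factor through it.
\<close>


section \<open>Complex matrices\<close>

lemma ctranspose_nth [simp]: "ctranspose A $ i $ j = cnj (A $ j $ i)"
  by (simp add: ctranspose_def)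

lemma ctranspose_mult: "ctranspose (A ** B) = ctranspose B ** ctranspose A"
  by (simp add: vec_eq_iff matrix_matrix_mult_def mult.commute)

lemma ctranspose_mat_1 [simp]: "ctranspose (mat 1) = mat 1"
  by (simp add: vec_eq_iff mat_def)

text \<open>Both sides are the same double sum over entries. Through it
  \<open>frobenius_norm\<close> becomes the Euclidean \<open>norm\<close>, and expansions of squared
  deviations become inner product algebra.\<close>

lemma Re_trace_mult_ctranspose: "Re (trace (A ** ctranspose B)) = A \<bullet> (B :: complex^'n^'n)"
  by (simp add: trace_def matrix_matrix_mult_def inner_vec_def inner_complex_def)

lemma frobenius_norm_eq_norm: "frobenius_norm A = norm A"
  by (simp add: frobenius_norm_def Re_trace_mult_ctranspose norm_eq_sqrt_inner)

lemma quad_form_inner_mult: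
  "Re (quad_form A z) = z \<bullet> (A *v z)"
  by (simp add: quad_form_def inner_vec_def inner_complex_def matrix_vector_mult_def sum_distrib_left
      Re_sum[symmetric] algebra_simps sum.distrib sum_subtractf)

lemma hermitian_pos_def_invertible:
  assumes "hermitian_pos_def A"
  shows "invertible A"
proof -
  have "z = 0" if "A *v z = 0" for z
  proof (rule ccontr)
    assume "z \<noteq> 0"
    then have "0 < Re (quad_form A z)" using assms by (simp add: hermitian_pos_def_def)
    then show False using that by (simp add: quad_form_inner_mult)
  qed
  then show ?thesis by (simp add: invertible_left_inverse matrix_left_invertible_ker)
qed

lemma matrix_inv_right:
  fixes A :: "'a::semiring_1^'n^'m"
  assumes "invertible A"
  shows "A ** matrix_inv A = mat 1"
  using someI_ex[OF assms[unfolded invertible_def]] by (simp add: matrix_inv_def)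

lemma hermitian_pos_def_matrix_inv:
  assumes A: "hermitian_pos_def A"
  shows "hermitian_pos_def (matrix_inv A)"
proof -
  note inv = hermitian_pos_def_invertible[OF A]
  have "ctranspose (A ** matrix_inv A) = mat 1" by (simp add: matrix_inv_right[OF inv])
  then have "ctranspose (matrix_inv A) ** A = mat 1"
    using A by (simp add: ctranspose_mult hermitian_pos_def_def)
  then have "ctranspose (matrix_inv A) = matrix_inv A"
    by (metis inv matrix_inv_right matrix_mul_assoc matrix_mul_lid matrix_mul_rid)
  moreover have "0 < Re (quad_form (matrix_inv A) z)" if "z \<noteq> 0" for z
  proof -
    \<comment> \<open>Substituting \<open>z = A *v w\<close> turns the form of the inverse at
      \<open>z\<close> into the form of \<open>A\<close> at \<open>w\<close>.\<close>
    define w where "w = matrix_inv A *v z"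
    have z: "z = A *v w" by (simp add: w_def matrix_vector_mul_assoc matrix_inv_right[OF inv])
    then have "w \<noteq> 0" using that by auto
    then have "0 < Re (quad_form A w)" using A by (simp add: hermitian_pos_def_def)
    then show ?thesis
      by (metis inner_commute quad_form_inner_mult w_def z)
  qed
  ultimately show ?thesis by (simp add: hermitian_pos_def_def)
qed

lemma hermitian_pos_def_mat_1: "hermitian_pos_def (mat 1 :: complex^'n^'n)"
  by (simp add: hermitian_pos_def_def quad_form_inner_mult)

text \<open>The form has a positive minimum on the compact unit sphere, and homogeneity of degree
  two carries the bound to all vectors. This later dominates the model densities by a Gaussian in
  the norm.\<close>

lemma quad_form_coercive:
  assumes "hermitian_pos_def (A :: complex^'n^'n)"
  obtains c where "0 < c" "\<And>z. c * (norm z)\<^sup>2 \<le> Re (quad_form A z)"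
proof -
  let ?S = "sphere 0 1 :: (complex^'n) set"
  have cont: "continuous_on ?S (\<lambda>z. Re (quad_form A z))"
    unfolding quad_form_def by (intro continuous_intros)
  have "\<exists>z\<in>?S. \<forall>w\<in>?S. Re (quad_form A z) \<le> Re (quad_form A w)"
    using continuous_attains_inf[OF compact_sphere _ cont] by simp
  then obtain z where z: "z \<in> ?S" "\<And>w. w \<in> ?S \<Longrightarrow> Re (quad_form A z) \<le> Re (quad_form A w)" by blast
  show ?thesis
  proof
    show "0 < Re (quad_form A z)" using assms z(1) unfolding hermitian_pos_def_def by (metis mem_sphere_0 norm_zero zero_neq_one)
    fix w
    show "Re (quad_form A z) * (norm w)\<^sup>2 \<le> Re (quad_form A w)"
    proof (cases "w = 0")
      case False
      define u where "u = (1 / norm w) *\<^sub>R w"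
      have w: "w = norm w *\<^sub>R u" using False by (simp add: u_def)
      have "quad_form A (r *\<^sub>R u) = r\<^sup>2 *\<^sub>R quad_form A u" for r
        by (simp add: quad_form_def scaleR_sum_right power2_eq_square)
      then have "Re (quad_form A w) = (norm w)\<^sup>2 * Re (quad_form A u)"
        by (subst w) simp
      moreover have "u \<in> ?S" using False by (simp add: u_def)
      ultimately show ?thesis using mult_right_mono[OF z(2)[of u], of "(norm w)\<^sup>2"] by (simp add: mult.commute)
    qed (simp add: quad_form_def)
  qed
qed

section \<open>Measurability of determinants and matrix inverses\<close>

lemma borel_measurable_vec_iff:
  fixes f :: "'a \<Rightarrow> 'b::euclidean_space^'n"
  shows "f \<in> borel_measurable M \<longleftrightarrow> (\<forall>i. (\<lambda>x. f x $ i) \<in> borel_measurable M)"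
proof
  assume [measurable]: "f \<in> borel_measurable M"
  have [measurable]: "(\<lambda>v :: 'b^'n. v $ i) \<in> borel_measurable borel" for i
    by (intro borel_measurable_continuous_onI continuous_intros)
  show "\<forall>i. (\<lambda>x. f x $ i) \<in> borel_measurable M" by measurable
next
  assume "\<forall>i. (\<lambda>x. f x $ i) \<in> borel_measurable M"
  then have [measurable]: "\<And>i. (\<lambda>x. f x $ i) \<in> borel_measurable M" by blast
  show "f \<in> borel_measurable M"
    by (subst borel_measurable_euclidean_space) (auto simp: Basis_vec_def inner_axis)
qed

lemma borel_measurable_det [measurable]:
  "det \<in> borel_measurable (borel :: (complex^'n^'n) measure)"
  unfolding det_def by (intro borel_measurable_continuous_onI continuous_intros)

text \<open>Off the measurable set \<open>det A = 0\<close>, Cramer's rule writes each entry of the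
  inverse as a quotient of determinants; on that set \<open>matrix_inv\<close> is constant. The two
  pieces are glued by a measurable case distinction.\<close>

lemma borel_measurable_matrix_inv [measurable]:
  "matrix_inv \<in> borel_measurable (borel :: (complex^'n^'n) measure)"
proof -
  let ?B = "\<lambda>A :: complex^'n^'n. \<lambda>l k. (\<chi> i j. if j = k then axis l 1 $ i else A $ i $ j) :: complex^'n^'n"
  \<comment> \<open>For singular \<open>A\<close> the predicate under the choice operator in
    \<open>matrix_inv\<close> is false everywhere, so all singular matrices share this one default
    value.\<close>
  define N :: "complex^'n^'n" where "N = (SOME A'. False)"
  have cramer_inv: "matrix_inv A = (if det A = 0 then N else (\<chi> k l. det (?B A l k) / det A))" for A :: "complex^'n^'n"
  proof (cases "det A = 0")
    case True
    then have "\<not> invertible A" by (simp add: invertible_det_nz)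
    then have "(\<lambda>A'. A ** A' = mat 1 \<and> A' ** A = mat 1) = (\<lambda>_. False)"
      by (auto simp: invertible_def fun_eq_iff)
    then show ?thesis using True by (simp add: matrix_inv_def N_def)
  next
    case False
    then have inv: "invertible A" by (simp add: invertible_det_nz)
    have "matrix_inv A $ k $ l = det (?B A l k) / det A" for k l
    proof -
      have "A *v (matrix_inv A *v axis l 1) = axis l 1"
        by (simp add: matrix_vector_mul_assoc matrix_inv_right[OF inv])
      then have "matrix_inv A *v axis l 1 = (\<chi> k. det (?B A l k) / det A)"
        by (simp add: cramer[OF False])
      moreover have "(matrix_inv A *v axis l 1) $ k = matrix_inv A $ k $ l"
        by (simp add: matrix_vector_mult_def axis_def if_distrib cong: if_cong)
      ultimately show ?thesis by simp
    qed
    then show ?thesis using False by (simp add: vec_eq_iff)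
  qed
  have "continuous_on UNIV (\<lambda>A :: complex^'n^'n. if j = k then axis l 1 $ i else A $ i $ j)" for i j k l
    by (cases "j = k"; simp; intro continuous_intros)
  then have [measurable]: "(\<lambda>A. det (?B A l k)) \<in> borel_measurable borel" for k l
    by (intro measurable_compose[OF _ borel_measurable_det] borel_measurable_continuous_onI continuous_on_vec_lambda)
  have "(\<lambda>A :: complex^'n^'n. (\<chi> k l. det (?B A l k) / det A) :: complex^'n^'n) \<in> borel_measurable borel"
    by (simp add: borel_measurable_vec_iff)
  then have "(\<lambda>A. if det A = 0 then N else (\<chi> k l. det (?B A l k) / det A)) \<in> borel_measurable borel"
    by (intro measurable_If) auto
  then show ?thesis by (simp add: cramer_inv[abs_def])
qed


section \<open>Lebesgue measure\<close>

lemma not_AE_lborel_False: "\<not> (AE x in (lborel :: 'a::euclidean_space measure). False)"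
  by (subst eventually_False, subst ae_filter_eq_bot_iff) simp

text \<open>The integrand is a product over an orthonormal basis, which reduces the claim to the
  one-dimensional normal density.\<close>

lemma nn_integral_gaussian_finite:
  assumes "0 < c"
  shows "(\<integral>\<^sup>+x. ennreal (exp (- (c * (norm x)\<^sup>2))) \<partial>(lborel :: 'a::euclidean_space measure)) < \<infinity>"
proof -
  have one: "(\<integral>\<^sup>+x. ennreal (exp (- (c * x\<^sup>2))) \<partial>lborel) < \<infinity>"
  proof -
    \<comment> \<open>The standard deviation for which the normal density has exponent
      \<open>- (c * x\<^sup>2)\<close>.\<close>
    define \<sigma> where "\<sigma> = 1 / sqrt (2 * c)"
    have \<sigma>: "0 < \<sigma>" "\<sigma>\<^sup>2 = 1 / (2 * c)" using assms by (simp_all add: \<sigma>_def power_divide)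
    have "integrable lborel (\<lambda>x. sqrt (2 * pi * \<sigma>\<^sup>2) * normal_density 0 \<sigma> x)"
      using integrable_normal_density[OF \<sigma>(1)] by simp
    also have "(\<lambda>x. sqrt (2 * pi * \<sigma>\<^sup>2) * normal_density 0 \<sigma> x) = (\<lambda>x. exp (- (c * x\<^sup>2)))"
      using assms by (simp add: normal_density_def \<sigma> fun_eq_iff field_simps)
    finally show ?thesis by (simp add: integrable_iff_bounded)
  qed
  have "(\<integral>\<^sup>+x. ennreal (exp (- (c * (norm x)\<^sup>2))) \<partial>(lborel :: 'a measure))
      = (\<integral>\<^sup>+x. (\<Prod>b\<in>Basis. ennreal (exp (- (c * (x \<bullet> b)\<^sup>2)))) \<partial>(lborel :: 'a measure))"
  proof (rule nn_integral_cong)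
    fix x :: 'a
    have "(norm x)\<^sup>2 = (\<Sum>b\<in>Basis. (x \<bullet> b)\<^sup>2)"
      by (subst power2_norm_eq_inner, subst euclidean_inner) (simp add: power2_eq_square)
    then show "ennreal (exp (- (c * (norm x)\<^sup>2))) = (\<Prod>b\<in>Basis. ennreal (exp (- (c * (x \<bullet> b)\<^sup>2))))"
      by (simp add: prod_ennreal exp_sum[symmetric] sum_negf sum_distrib_left)
  qed
  also have "\<dots> = (\<Prod>b\<in>(Basis :: 'a set). (\<integral>\<^sup>+x. ennreal (exp (- (c * x\<^sup>2))) \<partial>lborel))"
    by (rule nn_integral_lborel_prod) auto
  also have "\<dots> < \<infinity>" using one by (simp add: power_less_top_ennreal)
  finally show ?thesis .
qed

text \<open>
  Uniqueness of Haar measure: two translation invariant integrals are proportional by Tonelli's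
  theorem, and the Gaussian, a function of the norm, shows that the factor is 1.
\<close>

lemma orthogonal_transformation_nn_integral_lborel:
  fixes V :: "'a::euclidean_space \<Rightarrow> 'a"
  assumes V: "orthogonal_transformation V" and f[measurable]: "f \<in> borel_measurable borel"
  shows "(\<integral>\<^sup>+x. f (V x) \<partial>lborel) = (\<integral>\<^sup>+x. f x \<partial>lborel)"
proof -
  have lin: "linear V" using V orthogonal_transformation_linear by blast
  have [measurable]: "V \<in> borel_measurable borel"
    by (intro borel_measurable_continuous_onI linear_continuous_on) (simp add: lin linear_conv_bounded_linear[symmetric])
  define g where "g x = ennreal (exp (- (norm x)\<^sup>2))" for x :: 'a
  have [measurable]: "g \<in> borel_measurable borel" unfolding g_def by measurable
  have shift: "(\<integral>\<^sup>+x. h (a + x) \<partial>lborel) = (\<integral>\<^sup>+x. h x \<partial>lborel)"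
    if [measurable]: "h \<in> borel_measurable borel" for h :: "'a \<Rightarrow> ennreal" and a
    by (subst (2) lborel_distr_plus[symmetric, of a]) (simp add: nn_integral_distr)
  have refl: "(\<integral>\<^sup>+x. h (a - x) \<partial>lborel) = (\<integral>\<^sup>+x. h x \<partial>lborel)"
    if [measurable]: "h \<in> borel_measurable borel" for h :: "'a \<Rightarrow> ennreal" and a
  proof -
    have "lborel = distr lborel borel (\<lambda>x::'a. a - x)"
      using lborel_affine[of "-1" a] by (simp add: density_1)
    then have "(\<integral>\<^sup>+x. h x \<partial>lborel) = (\<integral>\<^sup>+x. h x \<partial>distr lborel borel (\<lambda>x::'a. a - x))" by simp
    then show ?thesis by (simp add: nn_integral_distr)
  qed
  \<comment> \<open>Since \<open>V\<close> is linear and onto, a translation after \<open>V\<close>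
    is a translation before it.\<close>
  have shiftV: "(\<integral>\<^sup>+x. h (y + V x) \<partial>lborel) = (\<integral>\<^sup>+x. h (V x) \<partial>lborel)"
    if [measurable]: "h \<in> borel_measurable borel" for h :: "'a \<Rightarrow> ennreal" and y
  proof -
    obtain a where "y = V a" using orthogonal_transformation_surj[OF V] by blast
    then have "(\<integral>\<^sup>+x. h (y + V x) \<partial>lborel) = (\<integral>\<^sup>+x. h (V (a + x)) \<partial>lborel)"
      using lin by (simp add: linear_add)
    also have "\<dots> = (\<integral>\<^sup>+x. h (V x) \<partial>lborel)" by (rule shift[where h="\<lambda>x. h (V x)"]) measurable
    finally show ?thesis .
  qed
  \<comment> \<open>The double integral of \<open>f (V x) * g (V x + y)\<close> is evaluated twice.
    Integrating over \<open>y\<close> first yields the integral of \<open>g\<close>; moving the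
    shift by \<open>y\<close> from \<open>g\<close> to \<open>f\<close> and then integrating over
    \<open>y\<close> yields the integral of \<open>f\<close>.\<close>
  have swap: "(\<integral>\<^sup>+x. f (V x) \<partial>lborel) * (\<integral>\<^sup>+y. g y \<partial>lborel)
      = (\<integral>\<^sup>+x. g (V x) \<partial>lborel) * (\<integral>\<^sup>+y. f y \<partial>lborel)"
  proof -
    have "(\<integral>\<^sup>+x. f (V x) \<partial>lborel) * (\<integral>\<^sup>+y. g y \<partial>lborel)
      = (\<integral>\<^sup>+x. f (V x) * (\<integral>\<^sup>+y. g y \<partial>lborel) \<partial>lborel)"
      by (simp add: nn_integral_multc)
    also have "\<dots> = (\<integral>\<^sup>+x. (\<integral>\<^sup>+y. f (V x) * g (V x + y) \<partial>lborel) \<partial>lborel)"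
      by (simp add: nn_integral_cmult shift)
    also have "\<dots> = (\<integral>\<^sup>+y. (\<integral>\<^sup>+x. f (V x) * g (V x + y) \<partial>lborel) \<partial>lborel)"
      by (rule lborel_pair.Fubini') measurable
    also have "\<dots> = (\<integral>\<^sup>+y. (\<integral>\<^sup>+x. f (- y + V x) * g (V x) \<partial>lborel) \<partial>lborel)"
      using shiftV[of "\<lambda>z. f z * g (z + y)" "- y" for y] by (simp add: algebra_simps)
    also have "\<dots> = (\<integral>\<^sup>+x. (\<integral>\<^sup>+y. f (- y + V x) * g (V x) \<partial>lborel) \<partial>lborel)"
      by (rule lborel_pair.Fubini') measurable
    also have "\<dots> = (\<integral>\<^sup>+x. (\<integral>\<^sup>+y. f (V x - y) \<partial>lborel) * g (V x) \<partial>lborel)"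
      by (simp add: nn_integral_multc)
    also have "\<dots> = (\<integral>\<^sup>+x. (\<integral>\<^sup>+y. f y \<partial>lborel) * g (V x) \<partial>lborel)"
      by (simp add: refl)
    also have "\<dots> = (\<integral>\<^sup>+x. g (V x) \<partial>lborel) * (\<integral>\<^sup>+y. f y \<partial>lborel)"
      by (simp add: nn_integral_cmult mult.commute)
    finally show ?thesis .
  qed
  have gV: "g (V x) = g x" for x by (simp add: g_def orthogonal_transformation_norm[OF V])
  have "(\<integral>\<^sup>+y. g y \<partial>lborel) \<noteq> 0" "(\<integral>\<^sup>+y. g y \<partial>lborel) \<noteq> \<infinity>"
    using nn_integral_gaussian_finite[of 1, where 'a='a]
    by (auto simp: g_def nn_integral_0_iff_AE not_AE_lborel_False)
  with swap show ?thesis by (simp add: gV mult.commute[of _ "\<integral>\<^sup>+y. g y \<partial>lborel"] ennreal_mult_cancel_left)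
qed

text \<open>
  By Tonelli, for almost every scale \<open>s\<close> almost every \<open>u\<close> satisfies \<open>P (x0 + s u)\<close>; a single such
  \<open>s \<noteq> 0\<close> suffices, since dilations preserve null sets.
\<close>

lemma AE_lborel_if_countable_on_rays:
  fixes x0 :: "'a::euclidean_space"
  assumes P[measurable]: "Measurable.pred borel P"
    and rays: "\<And>u. countable {s::real. \<not> P (x0 + s *\<^sub>R u)}"
  shows "AE x in lborel. P x"
proof -
  have "AE s in lborel. AE u in lborel. P (x0 + s *\<^sub>R u)"
  proof -
    have "AE u in lborel. AE s in lborel. P (x0 + s *\<^sub>R u)"
    proof (rule AE_I2)
      fix u
      have "emeasure lborel {s::real. \<not> P (x0 + s *\<^sub>R u)} = 0"
        by (rule emeasure_lborel_countable[OF rays])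
      then show "AE s in lborel. P (x0 + s *\<^sub>R u)"
        by (subst AE_iff_measurable[OF _ refl]) auto
    qed
    moreover have "Measurable.pred (borel \<Otimes>\<^sub>M borel) (\<lambda>x. P (x0 + fst x *\<^sub>R snd x))" by measurable
    ultimately show ?thesis by (subst lborel_pair.AE_commute) (auto simp: pred_def space_pair_measure cong: sets_pair_measure_cong)
  qed
  moreover have "AE s in lborel. s \<noteq> (0::real)" by (rule AE_lborel_singleton)
  ultimately have "AE s in lborel. s \<noteq> (0::real) \<and> (AE u in lborel. P (x0 + s *\<^sub>R u))" by auto
  then obtain s :: real where s: "s \<noteq> 0" "AE u in lborel. P (x0 + s *\<^sub>R u)"
    using eventually_happens not_AE_lborel_False[where 'a=real] unfolding eventually_False by blast
  define D where "D = density (distr lborel borel (\<lambda>x. x0 + s *\<^sub>R x)) (\<lambda>_. ennreal (\<bar>s\<bar>^DIM('a)))"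
  have "AE x in D. P x" using s(2) unfolding D_def by (subst AE_density) (auto simp: AE_distr_iff)
  moreover have "D = lborel" unfolding D_def by (rule lborel_affine[OF s(1), symmetric])
  ultimately show ?thesis by (simp only:)
qed


section \<open>Conditional expectation without integrability\<close>

text \<open>A nonnegative factor scales the positive and the negative part separately, so the
  product rule for \<open>nn_cond_exp\<close> applies to each part and no integrability
  enters.\<close>

lemma (in sigma_finite_subalgebra) real_cond_exp_mult_nonneg:
  assumes f[measurable]: "f \<in> borel_measurable F" and nonneg: "\<And>x. 0 \<le> f x"
    and g[measurable]: "g \<in> borel_measurable M"
  shows "AE x in M. real_cond_exp M F (\<lambda>x. f x * g x) x = f x * real_cond_exp M F g x"
proof -
  have pos: "AE x in M. ennreal (f x) * nn_cond_exp M F (\<lambda>x. ennreal (h x)) x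
      = nn_cond_exp M F (\<lambda>x. ennreal (f x * h x)) x"
    if [measurable]: "h \<in> borel_measurable M" for h
    using nn_cond_exp_prod[of "\<lambda>x. ennreal (f x)" "\<lambda>x. ennreal (h x)"] nonneg by (simp add: ennreal_mult')
  from pos[of g] pos[of "\<lambda>x. - g x"] show ?thesis
    by (auto simp: real_cond_exp_def enn2real_mult nonneg right_diff_distrib elim!: eventually_elim2
        dest!: sym[where t="nn_cond_exp _ _ _ _"])
qed

text \<open>The coefficients may fail to be integrable. A positive \<open>F\<close>-measurable
  factor \<open>c\<close> makes both bounded, ordinary linearity applies to the scaled functions,
  and \<open>c\<close> is cancelled by the product rule for nonnegative factors.\<close>

lemma (in finite_measure_subalgebra) real_cond_exp_affine:
  assumes a[measurable]: "a \<in> borel_measurable F" and b[measurable]: "b \<in> borel_measurable F"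
    and g[measurable]: "g \<in> borel_measurable M" and bounded: "\<And>x. \<bar>g x\<bar> \<le> 1"
  shows "AE x in M. real_cond_exp M F (\<lambda>x. a x + b x * g x) x = a x + b x * real_cond_exp M F g x"
proof -
  note [measurable] = measurable_from_subalg[OF subalg a] measurable_from_subalg[OF subalg b]
  define c where "c x = 1 / (1 + \<bar>a x\<bar> + \<bar>b x\<bar>)" for x
  have c_pos: "0 < c x" for x by (simp add: c_def add_pos_nonneg)
  have [measurable]: "c \<in> borel_measurable F" unfolding c_def by measurable
  note [measurable] = measurable_from_subalg[OF subalg \<open>c \<in> borel_measurable F\<close>]
  have ca: "\<bar>c x * a x\<bar> \<le> 1" and cb: "\<bar>c x * b x\<bar> \<le> 1" for x
    by (simp_all add: c_def abs_mult divide_le_eq_1 add_pos_nonneg)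
  have ia: "integrable M (\<lambda>x. c x * a x)" by (rule integrable_const_bound[of _ 1]) (use ca in auto)
  have "\<bar>c x * b x * g x\<bar> \<le> 1" for x
    using mult_mono[OF cb bounded, of x x] by (simp add: abs_mult)
  then have ib: "integrable M (\<lambda>x. c x * b x * g x)" by (intro integrable_const_bound[of _ 1]) auto
  have "AE x in M. real_cond_exp M F (\<lambda>x. c x * (a x + b x * g x)) x = c x * real_cond_exp M F (\<lambda>x. a x + b x * g x) x"
    by (rule real_cond_exp_mult_nonneg) (use c_pos less_imp_le in auto)
  moreover have "AE x in M. real_cond_exp M F (\<lambda>x. c x * a x + c x * b x * g x) x
      = real_cond_exp M F (\<lambda>x. c x * a x) x + real_cond_exp M F (\<lambda>x. c x * b x * g x) x"
    by (rule real_cond_exp_add[OF ia ib])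
  moreover have "AE x in M. real_cond_exp M F (\<lambda>x. c x * a x) x = c x * a x"
    by (rule real_cond_exp_F_meas[OF ia]) measurable
  moreover have "AE x in M. real_cond_exp M F (\<lambda>x. c x * b x * g x) x = c x * b x * real_cond_exp M F g x"
    by (rule real_cond_exp_mult[OF _ _ ib]) measurable
  ultimately show ?thesis
  proof eventually_elim
    case (elim x)
    then have "c x * real_cond_exp M F (\<lambda>x. a x + b x * g x) x = c x * (a x + b x * real_cond_exp M F g x)"
      by (simp add: algebra_simps)
    then show ?case using c_pos[of x] by simp
  qed
qed

text \<open>An \<open>F\<close>-measurable density can be absorbed into the test function in the
  defining integrals of the conditional expectation. This is the measure-theoretic core of the
  factorization criterion for sufficiency.\<close>

lemma (in sigma_finite_subalgebra) real_cond_exp_density: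
  assumes N: "sigma_finite_subalgebra (density M h) F" and h[measurable]: "h \<in> borel_measurable F"
    and g[measurable]: "g \<in> borel_measurable M"
  shows "AE x in density M h. real_cond_exp (density M h) F g x = real_cond_exp M F g x"
proof -
  interpret N: sigma_finite_subalgebra "density M h" F by fact
  note [measurable] = measurable_from_subalg[OF subalg h]
  have nn: "AE x in density M h. nn_cond_exp M F f x = nn_cond_exp (density M h) F f x"
    if [measurable]: "f \<in> borel_measurable M" for f
  proof (rule N.nn_cond_exp_charact)
    fix A assume A[measurable]: "A \<in> sets F"
    then have [measurable]: "A \<in> sets M" using subalg by (auto simp: subalgebra_def)
    have "(\<integral>\<^sup>+x\<in>A. f x \<partial>density M h) = (\<integral>\<^sup>+x. (h x * indicator A x) * f x \<partial>M)"
      by (simp add: nn_integral_density mult_ac)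
    also have "\<dots> = (\<integral>\<^sup>+x. (h x * indicator A x) * nn_cond_exp M F f x \<partial>M)"
      by (rule nn_cond_exp_intg[symmetric]) measurable
    also have "\<dots> = (\<integral>\<^sup>+x\<in>A. nn_cond_exp M F f x \<partial>density M h)"
      by (simp add: nn_integral_density mult_ac)
    finally show "(\<integral>\<^sup>+x\<in>A. f x \<partial>density M h) = (\<integral>\<^sup>+x\<in>A. nn_cond_exp M F f x \<partial>density M h)" .
  qed measurable
  from nn[of "\<lambda>x. ennreal (g x)"] nn[of "\<lambda>x. ennreal (- g x)"] show ?thesis
    by (auto simp: real_cond_exp_def elim: eventually_elim2)
qed

text \<open>The Doob-Dynkin factorization for nonnegative functions, by induction from indicators
  through multiples, sums and suprema.\<close>

lemma vimage_algebra_factor_ennreal: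
  fixes f :: "'a \<Rightarrow> ennreal"
  assumes "f \<in> borel_measurable (vimage_algebra X T N)" and T: "T \<in> X \<rightarrow> space N"
  shows "\<exists>g\<in>borel_measurable N. \<forall>x\<in>X. f x = g (T x)"
  using assms(1)
proof (induction rule: borel_measurable_induct)
  case (cong f g)
  then show ?case by (metis space_vimage_algebra)
next
  case (set A)
  then obtain B where "B \<in> sets N" "A = T -` B \<inter> X" using T by (auto simp: sets_vimage_algebra2)
  then show ?case by (intro bexI[of _ "indicator B"]) (auto simp: indicator_def)
next
  case (mult u c)
  then obtain g where "g \<in> borel_measurable N" "\<forall>x\<in>X. u x = g (T x)" by blast
  then show ?case by (intro bexI[of _ "\<lambda>y. c * g y"]) auto
next
  case (add u v)
  then obtain g h where "g \<in> borel_measurable N" "\<forall>x\<in>X. u x = g (T x)"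
    "h \<in> borel_measurable N" "\<forall>x\<in>X. v x = h (T x)" by blast
  then show ?case by (intro bexI[of _ "\<lambda>y. h y + g y"]) auto
next
  case (seq U)
  then obtain g where "\<And>i. g i \<in> borel_measurable N" "\<And>i. \<forall>x\<in>X. U i x = g i (T x)" by metis
  then show ?case by (intro bexI[of _ "\<lambda>y. SUP i. g i y"]) (auto simp: image_comp)
qed

lemma vimage_algebra_factor_real:
  fixes f :: "'a \<Rightarrow> real"
  assumes f[measurable]: "f \<in> borel_measurable (vimage_algebra X T N)" and T: "T \<in> X \<rightarrow> space N"
  shows "\<exists>g\<in>borel_measurable N. \<forall>x\<in>X. f x = g (T x)"
proof -
  obtain g h where gh[measurable]: "g \<in> borel_measurable N" "h \<in> borel_measurable N"
    and eq: "\<forall>x\<in>X. ennreal (f x) = g (T x)" "\<forall>x\<in>X. ennreal (- f x) = h (T x)"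
    using vimage_algebra_factor_ennreal[OF _ T, of "\<lambda>x. ennreal (f x)"]
      vimage_algebra_factor_ennreal[OF _ T, of "\<lambda>x. ennreal (- f x)"] by auto
  have "f x = enn2real (g (T x)) - enn2real (h (T x))" if "x \<in> X" for x
    using that by (cases "0 \<le> f x") (simp_all flip: eq[rule_format] add: ennreal_neg)
  then show ?thesis by (intro bexI[of _ "\<lambda>y. enn2real (g y) - enn2real (h y)"]) auto
qed


section \<open>The sample matrix and pair rotations\<close>

text \<open>Kept apart from \<open>periodogram\<close> so that it applies to any vector, in
  particular to rotated observations.\<close>

definition outer :: "complex^'n \<Rightarrow> complex^'n^'n"
  where "outer a = (\<chi> i j. a $ i * cnj (a $ j))"

text \<open>Both sides are the squared modulus of the Hermitian product of \<open>a\<close> and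
  \<open>b\<close>: the two real inner products are its real and imaginary parts. These parts are
  what rotations with \<open>c = 1\<close> and \<open>c = \<i>\<close> produce.\<close>

lemma inner_outer: "outer a \<bullet> outer b = (a \<bullet> b)\<^sup>2 + (a \<bullet> (\<i> *s b))\<^sup>2"
proof -
  define h where "h = (\<Sum>i\<in>UNIV. a $ i * cnj (b $ i))"
  have "outer a \<bullet> outer b = Re (\<Sum>i\<in>UNIV. \<Sum>j\<in>UNIV. (a $ i * cnj (b $ i)) * cnj (a $ j * cnj (b $ j)))"
    by (simp add: outer_def inner_vec_def inner_complex_def algebra_simps)
  also have "\<dots> = Re (h * cnj h)" by (simp only: h_def cnj_sum sum_product)
  also have "\<dots> = (Re h)\<^sup>2 + (Im h)\<^sup>2" by (simp add: power2_eq_square)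
  also have "Re h = a \<bullet> b" by (simp add: h_def inner_vec_def inner_complex_def)
  also have "Im h = a \<bullet> (\<i> *s b)" by (simp add: h_def inner_vec_def inner_complex_def)
  finally show ?thesis .
qed

lemma norm_outer: "norm (outer a) = (norm a)\<^sup>2"
proof -
  have "a \<bullet> (\<i> *s a) = 0" by (simp add: inner_vec_def inner_complex_def)
  then have "(norm (outer a))\<^sup>2 = ((norm a)\<^sup>2)\<^sup>2"
    by (simp add: power2_norm_eq_inner inner_outer)
  then show ?thesis by (metis norm_ge_zero power2_eq_imp_eq zero_le_power2)
qed

lemma norm_vec_power2: "(norm x)\<^sup>2 = (\<Sum>i\<in>UNIV. (norm (x $ i))\<^sup>2)"
  for x :: "'a::real_normed_vector^'n"
  by (simp add: norm_vec_def L2_set_def sum_nonneg)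

lemma trace_outer: "trace (outer a) = of_real ((norm a)\<^sup>2)"
  by (simp add: trace_def outer_def norm_vec_power2 complex_norm_square del: of_real_power)

lemma periodogram_eq_outer: "periodogram J k = outer (J $ k)"
  by (simp add: periodogram_def outer_def)

lemma S_hat_eq_outer: "S_hat (J :: complex^'p^'k) = (1 / real CARD('k)) *\<^sub>R (\<Sum>k\<in>UNIV. outer (J $ k))"
  by (simp add: S_hat_def periodogram_eq_outer)

lemma ctranspose_S_hat: "ctranspose (S_hat J) = S_hat J"
  by (simp add: vec_eq_iff S_hat_eq_outer outer_def mult.commute)

lemma trace_S_hat: "trace (S_hat (J :: complex^'p^'k)) = of_real ((norm J)\<^sup>2 / real CARD('k))"
proof -
  have "trace (S_hat J) = (1 / real CARD('k)) *\<^sub>R (\<Sum>k\<in>UNIV. trace (outer (J $ k)))"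
    by (simp add: trace_def S_hat_eq_outer scaleR_sum_right sum.swap[of _ "UNIV :: 'p set"])
  then show ?thesis
    by (simp add: trace_outer norm_vec_power2[of J] scaleR_conv_of_real)
qed

lemma Re_trace_S_hat_mult: "Re (trace (S_hat J ** S_hat J)) = (norm (S_hat J))\<^sup>2"
  using Re_trace_mult_ctranspose[of "S_hat J" "S_hat J"] by (simp add: ctranspose_S_hat power2_norm_eq_inner)

definition fourth_moment :: "complex^'p^'k \<Rightarrow> real"
  where "fourth_moment J = (\<Sum>k\<in>UNIV. norm (J $ k) ^ 4)"

text \<open>The periodograms sum to \<open>CARD('k)\<close> times \<open>S_hat J\<close>, so the
  cross terms of the expanded squares depend on \<open>S_hat J\<close> alone. This isolates
  \<open>fourth_moment\<close> as the only other ingredient.\<close>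

lemma rho_LW_eq:
  fixes J :: "complex^'p^'k"
  shows "rho_LW J = (fourth_moment J - real CARD('k) * (norm (S_hat J))\<^sup>2) /
    ((real CARD('k))\<^sup>2 * ((norm (S_hat J))\<^sup>2 - (Re (trace (S_hat J)))\<^sup>2 / real CARD('p)))"
proof -
  have sum: "(\<Sum>k\<in>UNIV. outer (J $ k)) = real CARD('k) *\<^sub>R S_hat J"
    by (simp add: S_hat_eq_outer)
  have "(frobenius_norm (periodogram J k - S_hat J))\<^sup>2
      = norm (J $ k) ^ 4 - 2 * (outer (J $ k) \<bullet> S_hat J) + (norm (S_hat J))\<^sup>2" for k
  proof -
    have "norm (J $ k) ^ 4 = (norm (outer (J $ k)))\<^sup>2" by (simp add: norm_outer)
    then show ?thesis
      by (simp add: frobenius_norm_eq_norm periodogram_eq_outer power2_norm_eq_inner inner_diff_left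
        inner_diff_right inner_commute)
  qed
  then have "(\<Sum>k\<in>UNIV. (frobenius_norm (periodogram J k - S_hat J))\<^sup>2)
      = fourth_moment J - 2 * ((\<Sum>k\<in>UNIV. outer (J $ k)) \<bullet> S_hat J) + real CARD('k) * (norm (S_hat J))\<^sup>2"
    by (simp add: sum.distrib sum_subtractf fourth_moment_def sum_distrib_left[symmetric] inner_sum_left)
  also have "\<dots> = fourth_moment J - real CARD('k) * (norm (S_hat J))\<^sup>2"
    unfolding sum by (simp add: power2_norm_eq_inner)
  finally show ?thesis by (simp add: rho_LW_def Re_trace_S_hat_mult)
qed

text \<open>A sum of squares of nonnegative numbers is at most the square of their sum, here
  \<open>(norm J)\<^sup>2\<close>. The bound is a function of \<open>S_hat J\<close>.\<close>

lemma fourth_moment_le: "fourth_moment (J :: complex^'p^'k) \<le> (real CARD('k) * Re (trace (S_hat J)))\<^sup>2"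
proof -
  have "fourth_moment J = (\<Sum>k\<in>UNIV. (norm (J $ k))\<^sup>2 * (norm (J $ k))\<^sup>2)"
    by (simp add: fourth_moment_def eval_nat_numeral mult_ac)
  also have "\<dots> \<le> (\<Sum>k\<in>UNIV. \<Sum>l\<in>UNIV. (norm (J $ k))\<^sup>2 * (norm (J $ l))\<^sup>2)"
    by (intro sum_mono member_le_sum) auto
  also have "\<dots> = ((norm J)\<^sup>2)\<^sup>2"
    by (simp add: sum_product[symmetric] power2_eq_square[of "sum _ _"] norm_vec_power2[of J])
  finally show ?thesis by (simp add: trace_S_hat)
qed

lemma fourth_moment_nonneg: "0 \<le> fourth_moment J"
  by (simp add: fourth_moment_def sum_nonneg)

section \<open>Rotations of pairs of observations\<close>

definition rotate_pair :: "'k \<Rightarrow> 'k \<Rightarrow> complex \<Rightarrow> complex^'p^'k \<Rightarrow> complex^'p^'k"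
  where "rotate_pair k l c J = (\<chi> j. if j = k then (1 / sqrt 2) *\<^sub>R (J $ k + c *s J $ l)
    else if j = l then (1 / sqrt 2) *\<^sub>R (J $ k - c *s J $ l) else J $ j)"

lemma sum_rotate_pair:
  fixes J :: "complex^'p^'k" and f :: "complex^'p \<Rightarrow> 'b::real_normed_vector"
  assumes "k \<noteq> l"
  shows "(\<Sum>j\<in>UNIV. f (rotate_pair k l c J $ j)) = (\<Sum>j\<in>UNIV. f (J $ j)) - f (J $ k) - f (J $ l)
    + f ((1 / sqrt 2) *\<^sub>R (J $ k + c *s J $ l)) + f ((1 / sqrt 2) *\<^sub>R (J $ k - c *s J $ l))"
proof -
  have split: "(\<Sum>j\<in>UNIV. g j) = g k + g l + (\<Sum>j\<in>UNIV - {k, l}. g j)" for g :: "'k \<Rightarrow> 'b"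
    using assms by (subst sum.subset_diff[of "{k, l}"]) auto
  show ?thesis
    using assms by (subst (1 2) split) (simp add: rotate_pair_def)
qed

text \<open>A parallelogram law: the mixed terms cancel, and a unimodular \<open>c\<close>
  disappears from \<open>outer (c *s b)\<close>. Equivalently, the rows are mixed by a unitary
  matrix.\<close>

lemma outer_rotate:
  assumes "cmod c = 1"
  shows "outer ((1 / sqrt 2) *\<^sub>R (a + c *s b)) + outer ((1 / sqrt 2) *\<^sub>R (a - c *s b)) = outer a + outer b"
proof -
  have c: "c * cnj c = 1" using assms by (simp add: complex_norm_square[symmetric])
  have half: "outer ((1 / sqrt 2) *\<^sub>R d) = (1/2) *\<^sub>R outer d" for d :: "complex^'a"
    by (simp add: outer_def vec_eq_iff complex_eq_iff field_simps)
  have "outer (a + c *s b) + outer (a - c *s b) = 2 *\<^sub>R (outer a + outer (c *s b))"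
    by (simp add: outer_def vec_eq_iff algebra_simps scaleR_2)
  moreover have "outer (c *s b) = outer b"
  proof -
    have "c * b $ i * (cnj c * cnj (b $ j)) = (c * cnj c) * (b $ i * cnj (b $ j))" for i j
      by (simp add: mult_ac)
    then show ?thesis by (simp add: outer_def vec_eq_iff c)
  qed
  ultimately show ?thesis by (simp add: half flip: scaleR_add_right)
qed

lemma S_hat_rotate_pair:
  assumes "k \<noteq> l" "cmod c = 1"
  shows "S_hat (rotate_pair k l c J) = S_hat J"
  using outer_rotate[OF assms(2), of "J $ k" "J $ l"]
  by (simp add: S_hat_eq_outer sum_rotate_pair[OF assms(1)] add.assoc)

text \<open>Norm preservation comes from the invariance of \<open>S_hat\<close>, because its trace
  is a fixed multiple of \<open>(norm J)\<^sup>2\<close>.\<close>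

lemma orthogonal_rotate_pair:
  fixes k l :: "'k::finite"
  assumes "k \<noteq> l" "cmod c = 1"
  shows "orthogonal_transformation (rotate_pair k l c :: complex^'p^'k \<Rightarrow> _)"
  unfolding orthogonal_transformation
proof
  show "linear (rotate_pair k l c :: complex^'p^'k \<Rightarrow> _)"
    by (rule linearI) (auto simp: rotate_pair_def vec_eq_iff algebra_simps)
  have "norm (rotate_pair k l c J) = norm J" for J :: "complex^'p^'k"
  proof -
    have "Re (trace (S_hat (rotate_pair k l c J))) = Re (trace (S_hat J))"
      by (simp add: S_hat_rotate_pair assms)
    then show ?thesis by (simp add: trace_S_hat)
  qed
  then show "\<forall>J :: complex^'p^'k. norm (rotate_pair k l c J) = norm J" by blast
qed

text \<open>The squared norms of the two combinations are \<open>s + 2 * h\<close> and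
  \<open>s - 2 * h\<close>, so their squares add up to an expression in \<open>h\<^sup>2\<close>.
  Using both \<open>c = 1\<close> and \<open>c = \<i>\<close> collects the two squares that
  \<open>inner_outer\<close> needs.\<close>

lemma fourth_moment_rotate_pair:
  assumes "k \<noteq> l"
  shows "fourth_moment (rotate_pair k l 1 J) + fourth_moment (rotate_pair k l \<i> J) - 2 * fourth_moment J
    = 2 * (norm (J $ k))\<^sup>2 * (norm (J $ l))\<^sup>2 + 2 * (outer (J $ k) \<bullet> outer (J $ l))
      - norm (J $ k) ^ 4 - norm (J $ l) ^ 4"
proof -
  define a b s where "a = norm (J $ k)" and "b = norm (J $ l)" and "s = a\<^sup>2 + b\<^sup>2"
  have *: "norm ((1 / sqrt 2) *\<^sub>R (J $ k + c *s J $ l)) ^ 4 + norm ((1 / sqrt 2) *\<^sub>R (J $ k - c *s J $ l)) ^ 4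
    = (s\<^sup>2 + 4 * (J $ k \<bullet> (c *s J $ l))\<^sup>2) / 2" if c: "cmod c = 1" for c
  proof -
    define h where "h = J $ k \<bullet> (c *s J $ l)"
    have half: "norm ((1 / sqrt 2) *\<^sub>R d) ^ 4 = ((norm d)\<^sup>2)\<^sup>2 / 4" for d :: "complex^'b"
      by (simp add: power_mult_distrib power_divide power4_eq_xxxx power2_eq_square)
    have nc: "norm (c *s J $ l) = b"
      using c by (simp add: b_def norm_vec_def norm_mult)
    have "(norm (J $ k + c *s J $ l))\<^sup>2 = s + 2 * h" "(norm (J $ k - c *s J $ l))\<^sup>2 = s - 2 * h"
      by (simp_all add: s_def h_def a_def nc[symmetric] power2_norm_eq_inner algebra_simps inner_commute)
    then show ?thesis unfolding half h_def[symmetric] by (simp only:) (simp add: power2_eq_square field_simps)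
  qed
  show ?thesis
    using *[of 1] *[of \<i>] unfolding fourth_moment_def sum_rotate_pair[OF assms, where f="\<lambda>v. norm v ^ 4"] inner_outer
    by (simp add: s_def a_def b_def power4_eq_xxxx) (simp add: power2_eq_square algebra_simps)
qed

text \<open>The pair identity is summed over all ordered pairs of distinct indices. Once completed
  to full double sums, the mixed products factor into the squared trace and the squared norm; the
  fourth powers and the diagonal correction account for the coefficient
  \<open>CARD('k) + 1\<close>.\<close>

lemma fourth_moment_average:
  fixes J :: "complex^'p^'k"
  shows "(real CARD('k) + 1) * fourth_moment J
    + (\<Sum>k\<in>UNIV. \<Sum>l\<in>UNIV - {k}. fourth_moment (rotate_pair k l 1 J) + fourth_moment (rotate_pair k l \<i> J)
        - 2 * fourth_moment J) / 2
    = (real CARD('k))\<^sup>2 * ((Re (trace (S_hat J)))\<^sup>2 + (norm (S_hat J))\<^sup>2)"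
proof -
  let ?K = "real CARD('k)"
  let ?g = "\<lambda>k l. 2 * (norm (J $ k))\<^sup>2 * (norm (J $ l))\<^sup>2 + 2 * (outer (J $ k) \<bullet> outer (J $ l))
      - norm (J $ k) ^ 4 - norm (J $ l) ^ 4"
  have sum: "(\<Sum>k\<in>UNIV. outer (J $ k)) = ?K *\<^sub>R S_hat J"
    by (simp add: S_hat_eq_outer)
  \<comment> \<open>The diagonal terms, added to complete the double sum, contribute
    \<open>2 * fourth_moment J\<close> in total.\<close>
  have diag: "?g k k = 2 * norm (J $ k) ^ 4" for k
    by (simp add: norm_outer power4_eq_xxxx power2_eq_square flip: power2_norm_eq_inner)
  have "(\<Sum>k\<in>UNIV. \<Sum>l\<in>UNIV - {k}. fourth_moment (rotate_pair k l 1 J) + fourth_moment (rotate_pair k l \<i> J)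
        - 2 * fourth_moment J) = (\<Sum>k\<in>UNIV. \<Sum>l\<in>UNIV - {k}. ?g k l)"
    by (intro sum.cong fourth_moment_rotate_pair) auto
  also have "\<dots> = (\<Sum>k\<in>UNIV. \<Sum>l\<in>UNIV. ?g k l) - 2 * fourth_moment J"
    by (subst sum_diff1) (simp_all only: finite UNIV_I if_True diag sum_subtractf[of "\<lambda>k. \<Sum>l\<in>UNIV. ?g k l"] fourth_moment_def sum_distrib_left)
  also have "(\<Sum>k\<in>UNIV. \<Sum>l\<in>UNIV. ?g k l) = 2 * ((\<Sum>k\<in>UNIV. (norm (J $ k))\<^sup>2) * (\<Sum>l\<in>UNIV. (norm (J $ l))\<^sup>2))
      + 2 * ((\<Sum>k\<in>UNIV. outer (J $ k)) \<bullet> (\<Sum>l\<in>UNIV. outer (J $ l))) - 2 * ?K * fourth_moment J"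
    unfolding sum_product inner_sum_left inner_sum_right
    by (simp add: sum.distrib sum_subtractf sum_negf fourth_moment_def sum_distrib_left mult.assoc
        sum.swap[of "\<lambda>k l. 2 * (outer (J $ k) \<bullet> outer (J $ l))"])
  also have "(\<Sum>k\<in>UNIV. (norm (J $ k))\<^sup>2) = ?K * Re (trace (S_hat J))"
    by (simp add: trace_S_hat norm_vec_power2[of J])
  finally show ?thesis unfolding sum
    by (simp add: power2_norm_eq_inner) (simp add: field_simps power2_eq_square)
qed


section \<open>Models whose density is a function of the sample matrix\<close>

lemma continuous_on_S_hat: "continuous_on UNIV (S_hat :: complex^'p^'k \<Rightarrow> _)"
  unfolding S_hat_def periodogram_def by (intro continuous_intros)

lemma borel_measurable_S_hat [measurable]: "S_hat \<in> borel_measurable borel"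
  by (rule borel_measurable_continuous_onI[OF continuous_on_S_hat])

lemma borel_measurable_trace [measurable]: "trace \<in> borel_measurable (borel :: (complex^'n^'n) measure)"
  unfolding trace_def by (intro borel_measurable_continuous_onI continuous_intros)

lemma borel_measurable_fourth_moment [measurable]: "fourth_moment \<in> borel_measurable borel"
  unfolding fourth_moment_def by (intro borel_measurable_continuous_onI continuous_intros)

lemma borel_measurable_rotate_pair:
  fixes k l :: "'k::finite"
  assumes "k \<noteq> l" "cmod c = 1"
  shows "(rotate_pair k l c :: complex^'p^'k \<Rightarrow> _) \<in> borel_measurable borel"
  using orthogonal_transformation_linear[OF orthogonal_rotate_pair[OF assms]]
  by (intro borel_measurable_continuous_onI linear_continuous_on) (simp add: linear_conv_bounded_linear)

lemma sigma_of_eq: "space M = UNIV \<Longrightarrow> sigma_of M T = vimage_algebra UNIV T borel"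
  by (simp add: sigma_of_def)

lemma measurable_sigma_of: "f \<in> borel_measurable borel \<Longrightarrow> (\<lambda>x. f (T x)) \<in> borel_measurable (sigma_of M T)"
  unfolding sigma_of_def
  by (rule measurable_compose[OF measurable_vimage_algebra1]) auto

text \<open>Covers both the Gaussian measures and the unnormalised reference measure of the
  sufficiency proof.\<close>

locale S_hat_model =
  fixes M :: "(complex^'p^'k) measure" and h :: "complex^'p^'p \<Rightarrow> ennreal"
  assumes h [measurable]: "h \<in> borel_measurable borel"
    and M_eq: "M = density lborel (\<lambda>J. h (S_hat J))"
    and finite_M: "emeasure M UNIV < \<infinity>"
begin

lemma space_M [simp]: "space M = UNIV" and sets_M [measurable_cong, simp]: "sets M = sets borel"
  by (simp_all add: M_eq)

sublocale finite_measure_subalgebra M "sigma_of M S_hat"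
proof (intro finite_measure_subalgebra.intro finite_measureI finite_measure_subalgebra_axioms.intro)
  show "emeasure M (space M) \<noteq> \<infinity>" using finite_M by auto
  have "S_hat -` A \<in> sets borel" if "A \<in> sets borel" for A :: "(complex^'p^'p) set"
    using measurable_sets_borel[OF borel_measurable_S_hat that] .
  then show "subalgebra M (sigma_of M S_hat)"
    by (auto simp: subalgebra_def sigma_of_eq sets_vimage_algebra2)
qed

text \<open>The rotation is orthogonal, so it preserves Lebesgue measure, and it fixes
  \<open>S_hat\<close>, so it preserves the density.\<close>

lemma distr_rotate_pair:
  assumes "k \<noteq> l" "cmod c = 1"
  shows "distr M M (rotate_pair k l c) = M"
proof (rule measure_eqI)
  let ?V = "rotate_pair k l c :: complex^'p^'k \<Rightarrow> _"
  note [measurable] = borel_measurable_rotate_pair[OF assms]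
  fix A assume "A \<in> sets (distr M M ?V)"
  then have [measurable]: "A \<in> sets borel" by simp
  then have [measurable]: "?V -` A \<in> sets borel"
    using measurable_sets_borel[OF borel_measurable_rotate_pair[OF assms]] by blast
  have "emeasure (distr M M ?V) A = emeasure M (?V -` A)" by (subst emeasure_distr) auto
  also have "\<dots> = (\<integral>\<^sup>+J. h (S_hat J) * indicator (?V -` A) J \<partial>lborel)"
    unfolding M_eq by (rule emeasure_density) auto
  also have "\<dots> = (\<integral>\<^sup>+J. (\<lambda>J. h (S_hat J) * indicator A J) (?V J) \<partial>lborel)"
    by (intro nn_integral_cong) (simp add: S_hat_rotate_pair[OF assms] indicator_def)
  also have "\<dots> = (\<integral>\<^sup>+J. h (S_hat J) * indicator A J \<partial>lborel)"
    by (rule orthogonal_transformation_nn_integral_lborel[OF orthogonal_rotate_pair[OF assms]]) measurable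
  also have "\<dots> = emeasure M A"
    unfolding M_eq by (rule emeasure_density[symmetric]) auto
  finally show "emeasure (distr M M ?V) A = emeasure M A" .
qed simp

text \<open>The scaling by a function of \<^const>\<open>S_hat\<close> makes the fourth moment bounded, hence integrable.\<close>

definition scaled_fourth_moment :: "complex^'p^'k \<Rightarrow> real"
  where "scaled_fourth_moment J = fourth_moment J / (1 + (real CARD('k) * Re (trace (S_hat J)))\<^sup>2)"

lemma denominator_pos: "0 < 1 + (x :: real)\<^sup>2"
  by (simp add: add_pos_nonneg)

lemma scaled_fourth_moment_bound: "\<bar>scaled_fourth_moment J\<bar> \<le> 1"
  using fourth_moment_le[of J] fourth_moment_nonneg[of J]
  by (simp add: scaled_fourth_moment_def denominator_pos abs_of_nonneg)

lemma borel_measurable_scaled_fourth_moment [measurable]: "scaled_fourth_moment \<in> borel_measurable borel"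
  unfolding scaled_fourth_moment_def by measurable

lemma scaled_fourth_moment_average:
  fixes J :: "complex^'p^'k"
  shows "(real CARD('k) + 1) * scaled_fourth_moment J
    + (\<Sum>k\<in>UNIV. \<Sum>l\<in>UNIV - {k}. scaled_fourth_moment (rotate_pair k l 1 J)
        + scaled_fourth_moment (rotate_pair k l \<i> J) - 2 * scaled_fourth_moment J) / 2
    = (real CARD('k))\<^sup>2 * ((Re (trace (S_hat J)))\<^sup>2 + (norm (S_hat J))\<^sup>2) /
      (1 + (real CARD('k) * Re (trace (S_hat J)))\<^sup>2)"
proof -
  let ?d = "1 + (real CARD('k) * Re (trace (S_hat J)))\<^sup>2"
  have "(\<Sum>k\<in>UNIV. \<Sum>l\<in>UNIV - {k}. scaled_fourth_moment (rotate_pair k l 1 J)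
        + scaled_fourth_moment (rotate_pair k l \<i> J) - 2 * scaled_fourth_moment J)
    = (\<Sum>k\<in>UNIV. \<Sum>l\<in>UNIV - {k}. (fourth_moment (rotate_pair k l 1 J)
        + fourth_moment (rotate_pair k l \<i> J) - 2 * fourth_moment J) / ?d)"
    by (intro sum.cong refl) (simp add: scaled_fourth_moment_def S_hat_rotate_pair diff_divide_distrib add_divide_distrib)
  then show ?thesis
    by (simp add: scaled_fourth_moment_def sum_divide_distrib[symmetric] fourth_moment_average[symmetric]
        add_divide_distrib)
qed

text \<open>Over an event determined by \<open>S_hat\<close>, a rotated copy of the scaled moment
  has the same integral as the original. The rotation differences in the averaging identity
  therefore integrate to zero, which leaves the candidate.\<close>

lemma cond_exp_scaled_fourth_moment:
  "AE J in M. real_cond_exp M (sigma_of M S_hat) scaled_fourth_moment J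
    = (real CARD('k))\<^sup>2 * ((Re (trace (S_hat J)))\<^sup>2 + (norm (S_hat J))\<^sup>2) /
      (1 + (real CARD('k) * Re (trace (S_hat J)))\<^sup>2) / (real CARD('k) + 1)"
  (is "AE J in M. _ = ?G J / ?K1")
proof (rule real_cond_exp_charact)
  have int: "integrable M (\<lambda>J. indicator A J * f J)"
    if [measurable]: "A \<in> sets borel" "f \<in> borel_measurable borel" and "\<And>J. \<bar>f J\<bar> \<le> B"
    for A and f :: "_ \<Rightarrow> real" and B
  proof (rule integrable_const_bound[of _ B])
    have "\<bar>indicator A J * f J\<bar> \<le> B" for J
      using that(3)[of J] by (auto simp: indicator_def split: if_splits)
    then show "AE J in M. norm (indicator A J * f J) \<le> B" by simp
  qed measurable
  note bound = scaled_fourth_moment_bound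
  show int_X: "integrable M scaled_fourth_moment"
    using int[of UNIV scaled_fourth_moment 1] bound by simp
  have [measurable]: "(\<lambda>J. ?G J / ?K1) \<in> borel_measurable (sigma_of M S_hat)"
    by (rule measurable_sigma_of[where f="\<lambda>A. (real CARD('k))\<^sup>2 * ((Re (trace A))\<^sup>2 + (norm A)\<^sup>2) /
      (1 + (real CARD('k) * Re (trace A))\<^sup>2) / (real CARD('k) + 1)"]) measurable
  then show "(\<lambda>J. ?G J / ?K1) \<in> borel_measurable (sigma_of M S_hat)" .
  have main: "integrable M (\<lambda>J. indicator A J * (?G J / ?K1)) \<and>
      (\<integral>J. indicator A J * scaled_fourth_moment J \<partial>M) = (\<integral>J. indicator A J * (?G J / ?K1) \<partial>M)"
    if A: "A \<in> sets (sigma_of M S_hat)" for A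
  proof -
    obtain B where B: "B \<in> sets borel" "A = S_hat -` B"
      using A by (auto simp: sigma_of_eq sets_vimage_algebra2)
    have [measurable]: "A \<in> sets borel"
      using A subalg by (auto simp: subalgebra_def)
    let ?X = "\<lambda>J. indicator A J * scaled_fourth_moment J"
    let ?R = "\<lambda>k l c J. indicator A J * scaled_fourth_moment (rotate_pair k l c J)"
    have intX: "integrable M ?X" using bound by (intro int[of _ _ 1]) auto
    have intR: "integrable M (?R k l c)" and eqR: "(\<integral>J. ?R k l c J \<partial>M) = (\<integral>J. ?X J \<partial>M)"
      if "k \<noteq> l" "cmod c = 1" for k l c
    proof -
      note [measurable] = borel_measurable_rotate_pair[OF that]
      show "integrable M (?R k l c)" using bound by (intro int[of _ _ 1]) auto
      have "(\<integral>J. ?R k l c J \<partial>M) = (\<integral>J. ?X (rotate_pair k l c J) \<partial>M)"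
        \<comment> \<open>\<open>A\<close> is a preimage under \<open>S_hat\<close>, so its
          indicator does not change under the rotation.\<close>
        by (intro Bochner_Integration.integral_cong) (auto simp: B(2) indicator_def S_hat_rotate_pair[OF that])
      also have "\<dots> = (\<integral>J. ?X J \<partial>distr M M (rotate_pair k l c))"
        by (rule integral_distr[symmetric]) measurable
      finally show "(\<integral>J. ?R k l c J \<partial>M) = (\<integral>J. ?X J \<partial>M)" by (simp add: distr_rotate_pair[OF that])
    qed
    have pointwise: "indicator A J * (?G J / ?K1) =
      ?X J + (\<Sum>k\<in>UNIV. \<Sum>l\<in>UNIV - {k}. ?R k l 1 J + ?R k l \<i> J - 2 * ?X J) / (2 * ?K1)" for J
    proof -
      have "(\<Sum>k\<in>UNIV. \<Sum>l\<in>UNIV - {k}. ?R k l 1 J + ?R k l \<i> J - 2 * ?X J)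
        = indicator A J * (\<Sum>k\<in>UNIV. \<Sum>l\<in>UNIV - {k}. scaled_fourth_moment (rotate_pair k l 1 J)
        + scaled_fourth_moment (rotate_pair k l \<i> J) - 2 * scaled_fourth_moment J)"
        by (simp add: sum_distrib_left algebra_simps)
      then show ?thesis
        unfolding scaled_fourth_moment_average[symmetric] by (simp add: field_simps)
    qed
    have intS: "integrable M (\<lambda>J. \<Sum>k\<in>UNIV. \<Sum>l\<in>UNIV - {k}. ?R k l 1 J + ?R k l \<i> J - 2 * ?X J)"
      using intX intR by (intro Bochner_Integration.integrable_sum Bochner_Integration.integrable_diff
          Bochner_Integration.integrable_add integrable_mult_right) auto
    have "(\<integral>J. (\<Sum>k\<in>UNIV. \<Sum>l\<in>UNIV - {k}. ?R k l 1 J + ?R k l \<i> J - 2 * ?X J) \<partial>M)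
      = (\<Sum>k\<in>UNIV. \<Sum>l\<in>UNIV - {k}. (\<integral>J. ?R k l 1 J + ?R k l \<i> J - 2 * ?X J \<partial>M))"
      using intX intR by (subst Bochner_Integration.integral_sum)
        (auto intro!: Bochner_Integration.integrable_sum sum.cong Bochner_Integration.integral_sum)
    also have "\<dots> = 0"
    proof (intro sum.neutral ballI)
      fix k l :: 'k assume "l \<in> UNIV - {k}"
      then have "k \<noteq> l" by auto
      then show "(\<integral>J. ?R k l 1 J + ?R k l \<i> J - 2 * ?X J \<partial>M) = 0"
        using intX intR[of k l] eqR[of k l] by simp
    qed
    finally have "(\<integral>J. (\<Sum>k\<in>UNIV. \<Sum>l\<in>UNIV - {k}. ?R k l 1 J + ?R k l \<i> J - 2 * ?X J) \<partial>M) = 0" .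
    then show ?thesis
      unfolding pointwise using intX intS by simp
  qed
  show "integrable M (\<lambda>J. ?G J / ?K1)" using main[of UNIV] sets.top[of "sigma_of M S_hat"]
    by (simp add: sigma_of_def)
  show "(\<integral>J\<in>A. scaled_fourth_moment J \<partial>M) = (\<integral>J\<in>A. ?G J / ?K1 \<partial>M)"
    if "A \<in> sets (sigma_of M S_hat)" for A
    using main[OF that] by (simp add: set_lebesgue_integral_def)
qed

end


section \<open>The Rao-Blackwell estimator in closed form\<close>

text \<open>The numerator of \<open>rho_LW_eq\<close> with \<open>fourth_moment\<close> replaced by
  its conditional expectation given the sample matrix.\<close>

definition rho_num :: "real \<Rightarrow> complex^'p^'p \<Rightarrow> real"
  where "rho_num K A = K\<^sup>2 * ((Re (trace A))\<^sup>2 + (norm A)\<^sup>2) / (K + 1) - K * (norm A)\<^sup>2"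

definition rho_den :: "real \<Rightarrow> complex^'p^'p \<Rightarrow> real"
  where "rho_den K A = K\<^sup>2 * ((norm A)\<^sup>2 - (Re (trace A))\<^sup>2 / real CARD('p))"

definition rho_RB :: "real \<Rightarrow> complex^'p^'p \<Rightarrow> real"
  where "rho_RB K A = rho_num K A / rho_den K A"

definition shrink_RB :: "real \<Rightarrow> complex^'p^'p \<Rightarrow> complex^'p^'p"
  where "shrink_RB K A = (1 - rho_RB K A) *\<^sub>R A + (rho_RB K A * (Re (trace A) / real CARD('p))) *\<^sub>R mat 1"

lemma borel_measurable_rho_num [measurable]: "rho_num K \<in> borel_measurable borel"
  unfolding rho_num_def by measurable

lemma borel_measurable_rho_den [measurable]: "rho_den K \<in> borel_measurable borel"
  unfolding rho_den_def by measurable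

lemma borel_measurable_rho_RB [measurable]: "rho_RB K \<in> borel_measurable borel"
  unfolding rho_RB_def by measurable

lemma borel_measurable_shrink_RB [measurable]: "shrink_RB K \<in> borel_measurable borel"
  unfolding shrink_RB_def by measurable

lemma borel_measurable_S_LW [measurable]: "S_LW \<in> borel_measurable borel"
  unfolding S_LW_def rho_LW_eq mu_hat_def by measurable

section \<open>Conditional expectation of the Ledoit-Wolf estimator\<close>

context S_hat_model
begin

text \<open>A linear functional of \<open>S_LW\<close> is affine in the scaled fourth moment with
  coefficients depending on \<open>S_hat\<close>, so \<open>real_cond_exp_affine\<close> applies.
  The functionals needed are the real and imaginary parts of entries.\<close>

lemma cond_exp_linear_S_LW:
  assumes L: "bounded_linear (L :: complex^'p^'p \<Rightarrow> real)"
  shows "AE J in M. real_cond_exp M (sigma_of M S_hat) (\<lambda>J. L (S_LW J)) J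
    = L (shrink_RB (real CARD('k)) (S_hat J))"
proof -
  interpret L: bounded_linear L by fact
  have [measurable]: "L \<in> borel_measurable borel"
    by (intro borel_measurable_continuous_onI linear_continuous_on L)
  define K p where "K = real CARD('k)" and "p = real CARD('p)"
  \<comment> \<open>Both intensities have denominator \<open>D\<close>. Where it vanishes, division
    by zero returns 0 for both, so the identities below need no case distinction.\<close>
  define D \<beta> a b :: "complex^'p^'p \<Rightarrow> real"
    where "D A = K\<^sup>2 * ((norm A)\<^sup>2 - (Re (trace A))\<^sup>2 / p)"
      and "\<beta> A = Re (trace A) / p * L (mat 1) - L A"
      and "a A = L A - \<beta> A * (K * (norm A)\<^sup>2) / D A"
      and "b A = \<beta> A * (1 + (K * Re (trace A))\<^sup>2) / D A" for A
  have [measurable]: "D \<in> borel_measurable borel" "\<beta> \<in> borel_measurable borel"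
    "a \<in> borel_measurable borel" "b \<in> borel_measurable borel"
    unfolding a_def b_def \<beta>_def D_def by measurable
  have "L (S_LW J) = a (S_hat J) + b (S_hat J) * scaled_fourth_moment J" for J
  proof -
    have "L (S_LW J) = L (S_hat J) + \<beta> (S_hat J) * rho_LW J"
      unfolding S_LW_def L.add L.scaleR \<beta>_def mu_hat_def p_def by (simp add: algebra_simps)
    also have "rho_LW J = (fourth_moment J - K * (norm (S_hat J))\<^sup>2) / D (S_hat J)"
      by (simp add: rho_LW_eq D_def K_def p_def)
    also have "fourth_moment J = scaled_fourth_moment J * (1 + (K * Re (trace (S_hat J)))\<^sup>2)"
      using denominator_pos[of "K * Re (trace (S_hat J))"] by (simp add: scaled_fourth_moment_def K_def)
    finally show ?thesis by (simp add: a_def b_def algebra_simps diff_divide_distrib add_divide_distrib)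
  qed
  moreover have "AE J in M. real_cond_exp M (sigma_of M S_hat) (\<lambda>J. a (S_hat J) + b (S_hat J) * scaled_fourth_moment J) J
      = a (S_hat J) + b (S_hat J) * real_cond_exp M (sigma_of M S_hat) scaled_fourth_moment J"
    by (rule real_cond_exp_affine) (auto intro: measurable_sigma_of scaled_fourth_moment_bound)
  moreover have "a A + b A * (K\<^sup>2 * ((Re (trace A))\<^sup>2 + (norm A)\<^sup>2) / (1 + (K * Re (trace A))\<^sup>2) / (K + 1))
      = L (shrink_RB K A)" for A
  proof -
    have "L (shrink_RB K A) = L A + \<beta> A * rho_RB K A"
      unfolding shrink_RB_def L.add L.scaleR \<beta>_def p_def by (simp add: algebra_simps)
    also have "rho_RB K A = (K\<^sup>2 * ((Re (trace A))\<^sup>2 + (norm A)\<^sup>2) / (K + 1) - K * (norm A)\<^sup>2) / D A"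
      by (simp add: rho_RB_def rho_num_def rho_den_def D_def p_def)
    also have "L A + \<beta> A * ((x / (K + 1) - K * (norm A)\<^sup>2) / D A) = a A + \<beta> A * (x / (K + 1) / D A)" for x
      by (simp add: a_def diff_divide_distrib right_diff_distrib)
    also have "\<beta> A * (x / (K + 1) / D A) = b A * (x / (1 + (K * Re (trace A))\<^sup>2) / (K + 1))" for x
      using denominator_pos[of "K * Re (trace A)"] by (simp add: b_def)
    finally show ?thesis ..
  qed
  ultimately show ?thesis using cond_exp_scaled_fourth_moment by (auto simp: K_def elim: eventually_elim2)
qed

lemma matrix_cond_exp_S_LW:
  "AE J in M. matrix_cond_exp M (sigma_of M S_hat) S_LW J = shrink_RB (real CARD('k)) (S_hat J)"
proof -
  have "AE J in M. real_cond_exp M (sigma_of M S_hat) (\<lambda>J. Re (S_LW J $ i $ j)) J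
      = Re (shrink_RB (real CARD('k)) (S_hat J) $ i $ j)" for i j
    by (rule cond_exp_linear_S_LW)
      (intro bounded_linear_compose[OF bounded_linear_Re] bounded_linear_compose[OF bounded_linear_vec_nth]
        bounded_linear_vec_nth)
  moreover have "AE J in M. real_cond_exp M (sigma_of M S_hat) (\<lambda>J. Im (S_LW J $ i $ j)) J
      = Im (shrink_RB (real CARD('k)) (S_hat J) $ i $ j)" for i j
    by (rule cond_exp_linear_S_LW)
      (intro bounded_linear_compose[OF bounded_linear_Im] bounded_linear_compose[OF bounded_linear_vec_nth]
        bounded_linear_vec_nth)
  ultimately have "AE J in M. \<forall>i j.
      real_cond_exp M (sigma_of M S_hat) (\<lambda>J. Re (S_LW J $ i $ j)) J = Re (shrink_RB (real CARD('k)) (S_hat J) $ i $ j) \<and>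
      real_cond_exp M (sigma_of M S_hat) (\<lambda>J. Im (S_LW J $ i $ j)) J = Im (shrink_RB (real CARD('k)) (S_hat J) $ i $ j)"
    by (simp add: AE_all_countable)
  then show ?thesis
    by eventually_elim (simp add: matrix_cond_exp_def vec_eq_iff complex_eq_iff)
qed

text \<open>The dominating function of \<open>S_hat\<close> is its own conditional expectation and
  takes finite values.\<close>

lemma nn_cond_exp_finite_if_bounded:
  assumes [measurable]: "X \<in> borel_measurable borel" "b \<in> borel_measurable borel"
    and bound: "\<And>J. norm (X J) \<le> b (S_hat J)"
  shows "AE J in M. nn_cond_exp M (sigma_of M S_hat) (\<lambda>J. ennreal (norm (X J))) J < \<infinity>"
proof -
  have "AE J in M. nn_cond_exp M (sigma_of M S_hat) (\<lambda>J. ennreal (norm (X J))) J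
      \<le> nn_cond_exp M (sigma_of M S_hat) (\<lambda>J. ennreal (b (S_hat J))) J"
    by (rule nn_cond_exp_mono) (auto intro: ennreal_leI bound)
  moreover have "AE J in M. ennreal (b (S_hat J)) = nn_cond_exp M (sigma_of M S_hat) (\<lambda>J. ennreal (b (S_hat J))) J"
    by (rule nn_cond_exp_F_meas) (rule measurable_sigma_of[where f="\<lambda>A. ennreal (b A)"], measurable)
  ultimately show ?thesis
    by eventually_elim (metis ennreal_less_top infinity_ennreal_def order_le_less_trans)
qed

text \<open>\<open>fourth_moment\<close> lies between 0 and a function of \<open>S_hat\<close>,
  hence so do \<open>rho_LW\<close> in absolute value and the norm of \<open>S_LW\<close>. This
  supplies the finiteness clause of \<open>cond_exp_given\<close>.\<close>

lemma nn_cond_exp_S_LW_finite: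
  "AE J in M. nn_cond_exp M (sigma_of M S_hat) (\<lambda>J. ennreal (norm (S_LW J))) J < \<infinity>"
proof -
  define K p where "K = real CARD('k)" and "p = real CARD('p)"
  define r :: "complex^'p^'p \<Rightarrow> real"
    where "r A = ((K * Re (trace A))\<^sup>2 + K * (norm A)\<^sup>2) / \<bar>K\<^sup>2 * ((norm A)\<^sup>2 - (Re (trace A))\<^sup>2 / p)\<bar>" for A
  have [measurable]: "r \<in> borel_measurable borel" unfolding r_def by measurable
  have rho: "\<bar>rho_LW J\<bar> \<le> r (S_hat J)" for J :: "complex^'p^'k"
  proof -
    have "\<bar>fourth_moment J - K * (norm (S_hat J))\<^sup>2\<bar> \<le> (K * Re (trace (S_hat J)))\<^sup>2 + K * (norm (S_hat J))\<^sup>2"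
      using fourth_moment_le[of J] fourth_moment_nonneg[of J]
      by (intro order_trans[OF abs_triangle_ineq4] add_mono) (simp_all add: K_def)
    then show ?thesis
      unfolding rho_LW_eq r_def K_def[symmetric] p_def[symmetric] abs_divide by (intro divide_right_mono) auto
  qed
  define b :: "complex^'p^'p \<Rightarrow> real"
    where "b A = (1 + r A) * norm A + (r A * \<bar>Re (trace A) / p\<bar>) * norm (mat 1 :: complex^'p^'p)" for A
  have [measurable]: "b \<in> borel_measurable borel" unfolding b_def by measurable
  have "norm (S_LW J) \<le> b (S_hat J)" for J :: "complex^'p^'k"
  proof -
    have "norm (S_LW J) \<le> \<bar>1 - rho_LW J\<bar> * norm (S_hat J) + (\<bar>rho_LW J\<bar> * \<bar>mu_hat J\<bar>) * norm (mat 1 :: complex^'p^'p)"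
      unfolding S_LW_def by (rule order_trans[OF norm_triangle_ineq]) (simp add: abs_mult)
    also have "\<dots> \<le> b (S_hat J)"
      unfolding b_def mu_hat_def p_def using rho[of J] by (intro add_mono mult_right_mono) auto
    finally show ?thesis .
  qed
  then show ?thesis by (intro nn_cond_exp_finite_if_bounded[where b=b]) auto
qed

end


section \<open>The Gaussian model\<close>

text \<open>The joint density of \<open>K\<close> observations read as a function of the sample
  matrix \<open>A\<close>.\<close>

definition cgauss_weight :: "nat \<Rightarrow> complex^'p^'p \<Rightarrow> complex^'p^'p \<Rightarrow> real"
  where "cgauss_weight K S A = exp (- (real K * Re (trace (matrix_inv S ** A)))) / (pi ^ CARD('p) * Re (det S)) ^ K"

lemma trace_mult_S_hat:
  fixes J :: "complex^'p^'k"
  shows "real CARD('k) * Re (trace (C ** S_hat J)) = (\<Sum>k\<in>UNIV. Re (quad_form C (J $ k)))"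
proof -
  have "(\<Sum>k\<in>UNIV. quad_form C (J $ k)) = (\<Sum>i\<in>UNIV. \<Sum>j\<in>UNIV. \<Sum>k\<in>UNIV. C $ i $ j * outer (J $ k) $ j $ i)"
    unfolding quad_form_def sum.swap[of _ "UNIV :: 'k set"]
    by (simp add: sum.swap[of _ "UNIV :: 'k set"] outer_def mult_ac)
  also have "\<dots> = real CARD('k) *\<^sub>R trace (C ** S_hat J)"
    by (simp add: trace_def matrix_matrix_mult_def S_hat_eq_outer scaleR_sum_right sum_distrib_left)
  finally show ?thesis by (metis Re_sum complex_scaleR(1) scaleR_complex.sel(1))
qed

lemma gauss_model_eq:
  "gauss_model S = density lborel (\<lambda>J::complex^'p^'k. ennreal (cgauss_weight CARD('k) S (S_hat J)))"
  unfolding gauss_model_def cgauss_density_def cgauss_weight_def trace_mult_S_hat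
  by (simp add: prod_dividef exp_sum[symmetric] sum_negf)

lemma borel_measurable_trace_mult [measurable]:
  "(\<lambda>A. trace (C ** A)) \<in> borel_measurable (borel :: (complex^'p^'p) measure)"
  unfolding trace_def matrix_matrix_mult_def
  by (intro borel_measurable_continuous_onI continuous_intros)

lemma borel_measurable_cgauss_weight [measurable]: "cgauss_weight K S \<in> borel_measurable borel"
  unfolding cgauss_weight_def by measurable

text \<open>Coercivity of the inverse covariance form bounds the joint density by a multiple of a
  Gaussian in \<open>norm J\<close>, which has finite integral.\<close>

lemma S_hat_model_gauss_model:
  assumes "hermitian_pos_def S"
  shows "S_hat_model (gauss_model S :: (complex^'p^'k) measure) (\<lambda>A. ennreal (cgauss_weight CARD('k) S A))"
proof
  show "gauss_model S = density lborel (\<lambda>J::complex^'p^'k. ennreal (cgauss_weight CARD('k) S (S_hat J)))"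
    by (rule gauss_model_eq)
  obtain c where c: "0 < c" "\<And>z. c * (norm z)\<^sup>2 \<le> Re (quad_form (matrix_inv S) z)"
    using quad_form_coercive[OF hermitian_pos_def_matrix_inv[OF assms]] by blast
  \<comment> \<open>The absolute value makes the bound independent of the sign of the
    determinant.\<close>
  define N where "N = \<bar>1 / (pi ^ CARD('p) * Re (det S)) ^ CARD('k)\<bar>"
  have "0 \<le> N" by (simp add: N_def)
  have le: "cgauss_weight CARD('k) S (S_hat J) \<le> N * exp (- (c * (norm J)\<^sup>2))" for J :: "complex^'p^'k"
  proof -
    have "c * (norm J)\<^sup>2 \<le> (\<Sum>k\<in>UNIV. Re (quad_form (matrix_inv S) (J $ k)))"
      unfolding norm_vec_power2[of J] sum_distrib_left by (intro sum_mono c(2))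
    then have "exp (- (\<Sum>k\<in>UNIV. Re (quad_form (matrix_inv S) (J $ k)))) \<le> exp (- (c * (norm J)\<^sup>2))" by simp
    then have "N * exp (- (\<Sum>k\<in>UNIV. Re (quad_form (matrix_inv S) (J $ k)))) \<le> N * exp (- (c * (norm J)\<^sup>2))"
      by (rule mult_left_mono) (simp add: N_def)
    moreover have "cgauss_weight CARD('k) S (S_hat J) \<le> N * exp (- (\<Sum>k\<in>UNIV. Re (quad_form (matrix_inv S) (J $ k))))"
      unfolding cgauss_weight_def trace_mult_S_hat N_def
      using mult_right_mono[OF abs_ge_self[of "1 / (pi ^ CARD('p) * Re (det S)) ^ CARD('k)"] exp_ge_zero] by simp
    ultimately show ?thesis by linarith
  qed
  have "emeasure (gauss_model S :: (complex^'p^'k) measure) UNIV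
      = (\<integral>\<^sup>+J. ennreal (cgauss_weight CARD('k) S (S_hat (J::complex^'p^'k))) \<partial>lborel)"
    unfolding gauss_model_eq by (subst emeasure_density) auto
  also have "\<dots> \<le> (\<integral>\<^sup>+J. ennreal N * ennreal (exp (- (c * (norm (J::complex^'p^'k))\<^sup>2))) \<partial>lborel)"
    by (intro nn_integral_mono) (simp add: \<open>0 \<le> N\<close> ennreal_mult[symmetric] le ennreal_leI)
  also have "\<dots> = ennreal N * (\<integral>\<^sup>+J. ennreal (exp (- (c * (norm (J::complex^'p^'k))\<^sup>2))) \<partial>lborel)"
    by (rule nn_integral_cmult) measurable
  also have "\<dots> < \<infinity>"
    using nn_integral_gaussian_finite[OF c(1), where 'a="complex^'p^'k"] by (simp add: ennreal_mult_less_top)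
  finally show "emeasure (gauss_model S :: (complex^'p^'k) measure) UNIV < \<infinity>" .
qed measurable


section \<open>Invertibility\<close>

text \<open>The parameter is real so that the class is closed under conjugation: the entries of
  \<open>S_hat\<close> involve conjugates and are polynomial along real lines only.\<close>

definition polynomial_in_real :: "(real \<Rightarrow> complex) \<Rightarrow> bool"
  where "polynomial_in_real g \<longleftrightarrow> (\<exists>p. \<forall>s. g s = poly p (complex_of_real s))"

lemma polynomial_in_real_const: "polynomial_in_real (\<lambda>s. c)"
  unfolding polynomial_in_real_def by (rule exI[of _ "[:c:]"]) simp

lemma polynomial_in_real_of_real: "polynomial_in_real (\<lambda>s. complex_of_real s)"
  unfolding polynomial_in_real_def by (rule exI[of _ "[:0, 1:]"]) simp

lemma polynomial_in_real_add:
  "polynomial_in_real f \<Longrightarrow> polynomial_in_real g \<Longrightarrow> polynomial_in_real (\<lambda>s. f s + g s)"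
  unfolding polynomial_in_real_def by (metis poly_add)

lemma polynomial_in_real_diff:
  "polynomial_in_real f \<Longrightarrow> polynomial_in_real g \<Longrightarrow> polynomial_in_real (\<lambda>s. f s - g s)"
  unfolding polynomial_in_real_def by (metis poly_diff)

lemma polynomial_in_real_mult:
  "polynomial_in_real f \<Longrightarrow> polynomial_in_real g \<Longrightarrow> polynomial_in_real (\<lambda>s. f s * g s)"
  unfolding polynomial_in_real_def by (metis poly_mult)

lemma polynomial_in_real_power: "polynomial_in_real f \<Longrightarrow> polynomial_in_real (\<lambda>s. f s ^ n)"
  unfolding polynomial_in_real_def by (metis poly_power)

lemma polynomial_in_real_sum:
  "(\<And>i. i \<in> I \<Longrightarrow> polynomial_in_real (f i)) \<Longrightarrow> polynomial_in_real (\<lambda>s. \<Sum>i\<in>I. f i s)"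
  by (induction I rule: infinite_finite_induct) (auto intro: polynomial_in_real_const polynomial_in_real_add)

lemma polynomial_in_real_prod:
  "(\<And>i. i \<in> I \<Longrightarrow> polynomial_in_real (f i)) \<Longrightarrow> polynomial_in_real (\<lambda>s. \<Prod>i\<in>I. f i s)"
  by (induction I rule: infinite_finite_induct) (auto intro: polynomial_in_real_const polynomial_in_real_mult)

lemma polynomial_in_real_cnj: "polynomial_in_real f \<Longrightarrow> polynomial_in_real (\<lambda>s. cnj (f s))"
proof -
  assume "polynomial_in_real f"
  then obtain p where "\<And>s. f s = poly p (complex_of_real s)" by (auto simp: polynomial_in_real_def)
  moreover have "cnj (poly p z) = poly (map_poly cnj p) (cnj z)" for z
    by (induction p) (simp_all add: map_poly_pCons)
  ultimately have "cnj (f s) = poly (map_poly cnj p) (complex_of_real s)" for s by simp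
  then show ?thesis unfolding polynomial_in_real_def by blast
qed

lemmas polynomial_in_real_intros = polynomial_in_real_const polynomial_in_real_of_real polynomial_in_real_add
  polynomial_in_real_diff polynomial_in_real_mult polynomial_in_real_power polynomial_in_real_sum
  polynomial_in_real_prod polynomial_in_real_cnj

lemma polynomial_in_real_Re: "polynomial_in_real f \<Longrightarrow> polynomial_in_real (\<lambda>s. of_real (Re (f s)))"
proof -
  have "complex_of_real (Re z) = (z + cnj z) * (1 / 2)" for z by (simp add: complex_add_cnj)
  then show "polynomial_in_real f \<Longrightarrow> ?thesis" by (simp only:) (intro polynomial_in_real_intros)
qed

lemma finite_zeros_polynomial_in_real:
  assumes "polynomial_in_real g" "g 0 \<noteq> 0"
  shows "finite {s. g s = 0}"
proof -
  obtain p where p: "\<And>s. g s = poly p (complex_of_real s)" using assms(1) by (auto simp: polynomial_in_real_def)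
  then have "p \<noteq> 0" using assms(2) by auto
  then have "finite (complex_of_real -` {z. poly p z = 0})"
    by (intro finite_vimageI poly_roots_finite) (auto simp: inj_on_def)
  then show ?thesis by (simp add: p vimage_def)
qed

section \<open>Almost sure invertibility through a cleared denominator\<close>

definition shrink_cleared :: "real \<Rightarrow> complex^'p^'p \<Rightarrow> complex^'p^'p"
  where "shrink_cleared K A = (rho_den K A - rho_num K A) *\<^sub>R A
    + (rho_num K A * (Re (trace A) / real CARD('p))) *\<^sub>R mat 1"

lemma borel_measurable_shrink_cleared [measurable]: "shrink_cleared K \<in> borel_measurable borel"
  unfolding shrink_cleared_def by measurable

text \<open>Where \<open>rho_den\<close> is nonzero, \<open>shrink_cleared\<close> is a nonzero
  multiple of \<open>shrink_RB\<close>; its determinant involves no quotient of data.\<close>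

lemma invertible_shrink_RB:
  assumes "rho_den K A \<noteq> 0" "det (shrink_cleared K A) \<noteq> 0"
  shows "invertible (shrink_RB K A)"
proof -
  have eq: "shrink_cleared K A = rho_den K A *\<^sub>R shrink_RB K A"
    using assms(1) by (simp add: shrink_cleared_def shrink_RB_def rho_RB_def scaleR_add_right right_diff_distrib)
  obtain B where "B ** shrink_cleared K A = mat 1"
    using assms(2) by (metis invertible_det_nz invertible_left_inverse)
  then have "(rho_den K A *\<^sub>R B) ** shrink_RB K A = mat 1"
    unfolding eq by (simp add: vec_eq_iff matrix_matrix_mult_def)
  then show ?thesis by (auto simp: invertible_left_inverse)
qed

text \<open>Along a line each entry of \<open>S_hat\<close> is a sum of products of an affine
  function and a conjugated one. Trace, squared norm and determinant are polynomial in these entries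
  and their conjugates.\<close>

lemma
  fixes J U :: "complex^'p^'k"
  shows polynomial_rho_den: "polynomial_in_real (\<lambda>s. of_real (rho_den K (S_hat (J + s *\<^sub>R U))))"
    and polynomial_det_shrink_cleared: "polynomial_in_real (\<lambda>s. det (shrink_cleared K (S_hat (J + s *\<^sub>R U))))"
proof -
  let ?A = "\<lambda>s. S_hat (J + s *\<^sub>R U)"
  have "?A s $ i $ j = of_real (1 / real CARD('k)) *
      (\<Sum>k\<in>UNIV. (J $ k $ i + of_real s * U $ k $ i) * cnj (J $ k $ j + of_real s * U $ k $ j))" for s i j
    by (simp add: S_hat_eq_outer outer_def) (simp add: scaleR_conv_of_real)
  then have A: "polynomial_in_real (\<lambda>s. ?A s $ i $ j)" for i j
    by (simp only:) (intro polynomial_in_real_intros)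
  have t: "polynomial_in_real (\<lambda>s. of_real (Re (trace (?A s))))"
    unfolding trace_def by (intro polynomial_in_real_Re polynomial_in_real_intros A)
  have "of_real ((norm (?A s))\<^sup>2) = (\<Sum>i\<in>UNIV. \<Sum>j\<in>UNIV. ?A s $ i $ j * cnj (?A s $ i $ j))" for s
    unfolding norm_vec_power2 by (simp add: complex_norm_square del: of_real_power)
  then have q: "polynomial_in_real (\<lambda>s. of_real ((norm (?A s))\<^sup>2))"
    by (simp only:) (intro polynomial_in_real_intros A)
  have num: "polynomial_in_real (\<lambda>s. of_real (rho_num K (?A s)))"
    unfolding rho_num_def of_real_diff of_real_mult of_real_add of_real_divide divide_inverse of_real_power[of "Re _"]
    by (intro polynomial_in_real_intros t q)
  show den: "polynomial_in_real (\<lambda>s. of_real (rho_den K (?A s)))"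
    unfolding rho_den_def of_real_diff of_real_mult of_real_add of_real_divide divide_inverse of_real_power[of "Re _"]
    by (intro polynomial_in_real_intros t q)
  have "shrink_cleared K (?A s) $ i $ j = (of_real (rho_den K (?A s)) - of_real (rho_num K (?A s))) * ?A s $ i $ j
      + of_real (rho_num K (?A s)) * (of_real (Re (trace (?A s))) * of_real (1 / real CARD('p))) * mat 1 $ i $ j" for s i j
    by (simp add: shrink_cleared_def) (simp add: scaleR_conv_of_real)
  then show "polynomial_in_real (\<lambda>s. det (shrink_cleared K (?A s)))"
    unfolding det_def by (simp only:) (intro polynomial_in_real_intros num den t A)
qed

text \<open>With a single nonzero observation along a coordinate axis the cleared matrix is
  diagonal, and an intensity strictly between 0 and 1 makes all its diagonal entries
  positive.\<close>

lemma rank_one_witness: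
  assumes p: "2 \<le> CARD('p::finite)" and k: "2 \<le> CARD('k::finite)"
  obtains J :: "complex^'p^'k" where "rho_den (real CARD('k)) (S_hat J) \<noteq> 0"
    "det (shrink_cleared (real CARD('k)) (S_hat J)) \<noteq> 0"
proof -
  define K p where "K = real CARD('k)" and "p = real CARD('p)"
  have K: "2 \<le> K" and p2: "2 \<le> p" using assms by (simp_all add: K_def p_def)
  fix k0 :: 'k and i0 :: 'p
  define J :: "complex^'p^'k" where "J = axis k0 (axis i0 1)"
  define A where "A = S_hat J"
  have "outer (J $ k) = (if k = k0 then outer (axis i0 1) else 0)" for k
    by (auto simp: J_def axis_def outer_def vec_eq_iff)
  then have A_outer: "A = (1 / K) *\<^sub>R outer (axis i0 1)"
    by (simp add: A_def S_hat_eq_outer K_def)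
  have A_nth: "A $ i $ j = (if i = i0 \<and> j = i0 then of_real (1 / K) else 0)" for i j
    by (simp add: A_outer outer_def axis_def complex_eq_iff)
  have q: "(norm A)\<^sup>2 = 1 / K\<^sup>2"
    using K by (simp add: A_outer norm_outer power_divide)
  have t: "Re (trace A) = 1 / K"
    by (simp add: A_def trace_S_hat J_def K_def)
  have den: "rho_den K A = 1 - 1 / p" and num: "rho_num K A = 2 / (K + 1) - 1 / K"
    unfolding rho_den_def rho_num_def q t p_def[symmetric] using K by (simp_all add: field_simps power2_eq_square)
  \<comment> \<open>These bounds combine to
    \<open>rho_num K A < 1 / K \<le> 1 / 2 \<le> 1 - 1 / p\<close>. For \<open>K = 1\<close> the
    numerator would be 0 and the singular sample matrix would remain unshrunk.\<close>
  have "1 / K \<le> 1 / 2" "1 / p \<le> 1 / 2" using K p2 by (simp_all add: field_simps)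
  moreover have "1 / K < 2 / (K + 1)" using K by (simp add: field_simps)
  moreover have "2 / (K + 1) < 2 * (1 / K)" using K by (simp add: field_simps)
  ultimately have pos: "0 < rho_den K A" "0 < rho_num K A" "rho_num K A < rho_den K A"
    unfolding den num by linarith+
  have diag: "shrink_cleared K A $ i $ j = 0" if "i \<noteq> j" for i j
    using that by (auto simp: shrink_cleared_def A_nth mat_def)
  have "Re (shrink_cleared K A $ i $ i) > 0" for i
    using pos K p2 by (auto simp: shrink_cleared_def A_nth mat_def t p_def[symmetric] intro!: add_nonneg_pos)
  then have "shrink_cleared K A $ i $ i \<noteq> 0" for i by (metis less_irrefl zero_complex.sel(1))
  then have "det (shrink_cleared K A) \<noteq> 0" using diag by (subst det_diagonal) auto
  then show ?thesis using pos(1) that[of J] by (auto simp: A_def K_def)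
qed

text \<open>Rays start at the witness, where both polynomials are nonzero; on every ray each of them
  then has finitely many zeros.\<close>

lemma AE_invertible_shrink_RB:
  assumes "2 \<le> CARD('p::finite)" and "2 \<le> CARD('k::finite)"
  shows "AE J in lborel. invertible (shrink_RB (real CARD('k)) (S_hat (J :: complex^'p^'k)))"
proof -
  obtain J0 :: "complex^'p^'k" where J0: "rho_den (real CARD('k)) (S_hat J0) \<noteq> 0"
    "det (shrink_cleared (real CARD('k)) (S_hat J0)) \<noteq> 0"
    by (rule rank_one_witness[OF assms])
  have "AE J in lborel. complex_of_real (rho_den (real CARD('k)) (S_hat (J :: complex^'p^'k))) \<noteq> 0"
    using finite_zeros_polynomial_in_real[OF polynomial_rho_den[of "real CARD('k)" J0]] J0(1)
    by (intro AE_lborel_if_countable_on_rays[where ?x0.0=J0]) (auto intro: countable_finite)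
  moreover have "AE J in lborel. det (shrink_cleared (real CARD('k)) (S_hat (J :: complex^'p^'k))) \<noteq> 0"
    using finite_zeros_polynomial_in_real[OF polynomial_det_shrink_cleared[of "real CARD('k)" J0]] J0(2)
    by (intro AE_lborel_if_countable_on_rays[where ?x0.0=J0]) (auto intro: countable_finite)
  ultimately show ?thesis by eventually_elim (simp add: invertible_shrink_RB)
qed


section \<open>Sufficiency and Rao-Blackwellization\<close>

text \<open>All model measures have densities depending on \<open>S_hat\<close> with respect to one
  finite measure \<open>M0\<close>. The conditional probability under \<open>M0\<close>, factored
  through \<open>S_hat\<close>, is then a version common to all parameters.\<close>

lemma sufficient_for_S_hat:
  "sufficient_for {C. hermitian_pos_def C} (\<lambda>C. gauss_model (matrix_inv C) :: (complex^'p^'k) measure) S_hat"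
  unfolding sufficient_for_def
proof (intro conjI ballI allI impI)
  fix C :: "complex^'p^'p" assume "C \<in> {C. hermitian_pos_def C}"
  show "S_hat \<in> borel_measurable (gauss_model (matrix_inv C) :: (complex^'p^'k) measure)"
    unfolding gauss_model_eq by measurable
next
  fix A :: "(complex^'p^'k) set"
  assume "\<forall>C\<in>{C :: complex^'p^'p. hermitian_pos_def C}. A \<in> sets (gauss_model (matrix_inv C))"
  then have [measurable]: "A \<in> sets borel"
    using hermitian_pos_def_mat_1[where 'n='p] by (auto simp: gauss_model_eq)
  \<comment> \<open>Evaluated at \<open>S_hat J\<close> this is
    \<open>exp (- (norm J)\<^sup>2)\<close>. It is positive everywhere, so densities with respect to
    \<open>M0\<close> arise by division.\<close>
  define h0 :: "complex^'p^'p \<Rightarrow> real" where "h0 A = exp (- (real CARD('k) * Re (trace A)))" for A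
  have [measurable]: "h0 \<in> borel_measurable borel" unfolding h0_def by measurable
  have h0_pos: "0 < h0 A" for A by (simp add: h0_def)
  define M0 :: "(complex^'p^'k) measure" where "M0 = density lborel (\<lambda>J. ennreal (h0 (S_hat J)))"
  interpret M0: S_hat_model M0 "\<lambda>A. ennreal (h0 A)"
  proof
    have "emeasure M0 UNIV = (\<integral>\<^sup>+J. ennreal (exp (- (1 * (norm (J :: complex^'p^'k))\<^sup>2))) \<partial>lborel)"
      unfolding M0_def by (subst emeasure_density) (auto simp: h0_def trace_S_hat)
    also have "\<dots> < \<infinity>" by (rule nn_integral_gaussian_finite) simp
    finally show "emeasure M0 UNIV < \<infinity>" .
  qed (simp_all add: M0_def)
  let ?F = "vimage_algebra UNIV S_hat borel :: (complex^'p^'k) measure"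
  have F: "sigma_of M0 S_hat = ?F" by (simp add: sigma_of_eq)
  have "real_cond_exp M0 ?F (indicat_real A) \<in> borel_measurable ?F" by simp
  then obtain g :: "complex^'p^'p \<Rightarrow> real" where g: "g \<in> borel_measurable borel"
    "\<And>J. real_cond_exp M0 ?F (indicat_real A) J = g (S_hat J)"
    using vimage_algebra_factor_real[of "real_cond_exp M0 ?F (indicat_real A)" UNIV S_hat borel] by auto
  have "AE J in gauss_model (matrix_inv C). real_cond_exp (gauss_model (matrix_inv C))
      (sigma_of (gauss_model (matrix_inv C)) S_hat) (indicat_real A) J = g (S_hat J)"
    if "hermitian_pos_def C" for C :: "complex^'p^'p"
  proof -
    define M :: "(complex^'p^'k) measure" where "M = gauss_model (matrix_inv C)"
    define w where "w A = cgauss_weight CARD('k) (matrix_inv C) A" for A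
    have [measurable]: "w \<in> borel_measurable borel" unfolding w_def by measurable
    interpret S_hat_model M "\<lambda>A. ennreal (w A)"
      unfolding M_def w_def by (rule S_hat_model_gauss_model[OF hermitian_pos_def_matrix_inv[OF that]])
    let ?h = "\<lambda>J. ennreal (w (S_hat J) / h0 (S_hat J))"
    have M: "M = density M0 ?h"
      using h0_pos
      by (simp add: M_eq M0_def density_density_eq ennreal_mult''[symmetric] ennreal_mult'[symmetric] less_imp_le less_imp_neq[THEN not_sym])
    have FM: "sigma_of M S_hat = ?F" by (simp add: sigma_of_eq)
    have "?h \<in> borel_measurable ?F"
      unfolding F[symmetric] by (rule measurable_sigma_of[where f="\<lambda>A. ennreal (w A / h0 A)"]) measurable
    moreover have "sigma_finite_subalgebra (density M0 ?h) ?F"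
      using sigma_finite_subalgebra_axioms unfolding FM M[symmetric] .
    ultimately have "AE J in M. real_cond_exp M ?F (indicat_real A) J = real_cond_exp M0 ?F (indicat_real A) J"
      unfolding M F[symmetric] by (intro M0.real_cond_exp_density) auto
    then show ?thesis unfolding g(2) unfolding M_def[symmetric] FM .
  qed
  then show "\<exists>g. g \<in> borel_measurable borel \<and> (\<forall>C\<in>{C. hermitian_pos_def C}. AE J in gauss_model (matrix_inv C).
      real_cond_exp (gauss_model (matrix_inv C)) (sigma_of (gauss_model (matrix_inv C)) S_hat) (indicat_real A) J
        = g (S_hat J))"
    using g(1) by blast
qed

text \<open>A function measurable with respect to \<open>T\<close> is its own conditional
  expectation in the extended sense; finiteness holds because its norm takes finite values.\<close>

lemma cond_exp_given_of_measurable: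
  assumes model: "\<And>\<theta>. \<theta> \<in> \<Theta> \<Longrightarrow> finite_measure_subalgebra (P \<theta>) (sigma_of (P \<theta>) T)"
    and T: "\<And>\<theta>. \<theta> \<in> \<Theta> \<Longrightarrow> T \<in> borel_measurable (P \<theta>)"
    and Y: "\<And>\<theta>. \<theta> \<in> \<Theta> \<Longrightarrow> Y \<in> borel_measurable (sigma_of (P \<theta>) T)"
  shows "cond_exp_given \<Theta> P Y T Y"
  unfolding cond_exp_given_def
proof (intro ballI conjI)
  fix \<theta> assume \<theta>: "\<theta> \<in> \<Theta>"
  let ?F = "sigma_of (P \<theta>) T"
  interpret finite_measure_subalgebra "P \<theta>" ?F by (rule model[OF \<theta>])
  note [measurable] = Y[OF \<theta>]
  show "T \<in> borel_measurable (P \<theta>)" "Y \<in> borel_measurable ?F" "Y \<in> borel_measurable (P \<theta>)"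
    by (fact T[OF \<theta>] Y[OF \<theta>] measurable_from_subalg[OF subalg Y[OF \<theta>]])+
  have "AE \<omega> in P \<theta>. ennreal (norm (Y \<omega>)) = nn_cond_exp (P \<theta>) ?F (\<lambda>\<omega>. ennreal (norm (Y \<omega>))) \<omega>"
    by (rule nn_cond_exp_F_meas) measurable
  then show "AE \<omega> in P \<theta>. nn_cond_exp (P \<theta>) ?F (\<lambda>\<omega>. ennreal (norm (Y \<omega>))) \<omega> < \<infinity>"
    by eventually_elim (metis ennreal_less_top infinity_ennreal_def)
  have self: "AE \<omega> in P \<theta>. real_cond_exp (P \<theta>) ?F f \<omega> = f \<omega>" if "f \<in> borel_measurable ?F" for f
  proof -
    \<comment> \<open>The affine rule with zero second coefficient covers functions \<open>f\<close>
      that are not integrable.\<close>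
    have "AE \<omega> in P \<theta>. real_cond_exp (P \<theta>) ?F (\<lambda>\<omega>. f \<omega> + 0 * 0) \<omega> = f \<omega> + 0 * real_cond_exp (P \<theta>) ?F (\<lambda>_. 0) \<omega>"
      by (rule real_cond_exp_affine[OF that]) auto
    then show ?thesis by simp
  qed
  have [measurable]: "(\<lambda>\<omega>. Y \<omega> $ i $ j) \<in> borel_measurable ?F" for i j
    using Y[OF \<theta>] unfolding borel_measurable_vec_iff by blast
  have "AE \<omega> in P \<theta>. \<forall>i j. real_cond_exp (P \<theta>) ?F (\<lambda>\<omega>. Re (Y \<omega> $ i $ j)) \<omega> = Re (Y \<omega> $ i $ j)
      \<and> real_cond_exp (P \<theta>) ?F (\<lambda>\<omega>. Im (Y \<omega> $ i $ j)) \<omega> = Im (Y \<omega> $ i $ j)"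
    by (intro AE_all_countable[THEN iffD2] allI AE_conjI self) measurable
  then show "AE \<omega> in P \<theta>. Y \<omega> = matrix_cond_exp (P \<theta>) ?F Y \<omega>"
    by eventually_elim (simp add: matrix_cond_exp_def vec_eq_iff complex_eq_iff)
qed

lemma rao_blackwell_estimator_shrink_RB:
  "rao_blackwell_estimator (\<lambda>J :: complex^'p^'k. shrink_RB (real CARD('k)) (S_hat J))"
  unfolding rao_blackwell_estimator_def cond_exp_given_def
proof (intro ballI conjI)
  fix S :: "complex^'p^'p" assume "S \<in> {S. hermitian_pos_def S}"
  then interpret S_hat_model "gauss_model S :: (complex^'p^'k) measure" "\<lambda>A. ennreal (cgauss_weight CARD('k) S A)"
    by (intro S_hat_model_gauss_model) simp
  let ?M = "gauss_model S :: (complex^'p^'k) measure"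
  show "S_hat \<in> borel_measurable ?M" "S_LW \<in> borel_measurable ?M" by simp_all
  show "(\<lambda>J. shrink_RB (real CARD('k)) (S_hat J)) \<in> borel_measurable (sigma_of ?M S_hat)"
    by (rule measurable_sigma_of) measurable
  show "AE J in ?M. nn_cond_exp ?M (sigma_of ?M S_hat) (\<lambda>J. ennreal (norm (S_LW J))) J < \<infinity>"
    by (rule nn_cond_exp_S_LW_finite)
  show "AE J in ?M. shrink_RB (real CARD('k)) (S_hat J) = matrix_cond_exp ?M (sigma_of ?M S_hat) S_LW J"
    using matrix_cond_exp_S_LW by eventually_elim simp
qed

text \<open>Both sides agree almost everywhere with the same \<open>matrix_cond_exp\<close>, so the
  closed form transfers to every version of the estimator.\<close>

lemma rao_blackwell_estimator_AE_eq:
  assumes "rao_blackwell_estimator (Y :: complex^'p^'k \<Rightarrow> _)" "hermitian_pos_def S"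
  shows "AE J in gauss_model S. Y J = shrink_RB (real CARD('k)) (S_hat J)"
proof -
  have "AE J in gauss_model S. Y J = matrix_cond_exp (gauss_model S) (sigma_of (gauss_model S) S_hat) S_LW J"
    and "AE J in gauss_model S. shrink_RB (real CARD('k)) (S_hat J)
      = matrix_cond_exp (gauss_model S) (sigma_of (gauss_model S) (S_hat :: complex^'p^'k \<Rightarrow> _)) S_LW J"
    using assms(1) rao_blackwell_estimator_shrink_RB assms(2)
    unfolding rao_blackwell_estimator_def cond_exp_given_def by blast+
  then show ?thesis by eventually_elim simp
qed

text \<open>Existence keeps the quantification over versions from being vacuous, and almost sure
  invertibility makes \<open>matrix_inv\<close> a genuine inverse instead of a default value. The
  model is indexed by the precision matrix, the parameter being estimated.\<close>

theorem lemma1: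
  assumes "2 \<le> CARD('p::finite)" and "2 \<le> CARD('k::finite)"
  shows "(\<exists>S_RB :: complex^'p^'k \<Rightarrow> complex^'p^'p. rao_blackwell_estimator S_RB) \<and>
    (\<forall>S_RB :: complex^'p^'k \<Rightarrow> complex^'p^'p. rao_blackwell_estimator S_RB \<longrightarrow>
      (\<forall>C. hermitian_pos_def C \<longrightarrow>
         (AE J in gauss_model (matrix_inv C). invertible (S_RB J))) \<and>
      rao_blackwellized_given {C. hermitian_pos_def C} (\<lambda>C. gauss_model (matrix_inv C))
        S_hat (\<lambda>J. matrix_inv (S_RB J)))"
proof (intro conjI allI impI)
  show "\<exists>S_RB :: complex^'p^'k \<Rightarrow> complex^'p^'p. rao_blackwell_estimator S_RB"
    using rao_blackwell_estimator_shrink_RB by blast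
next
  fix S_RB :: "complex^'p^'k \<Rightarrow> complex^'p^'p" and C :: "complex^'p^'p"
  assume S_RB: "rao_blackwell_estimator S_RB" and C: "hermitian_pos_def C"
  have "AE J in gauss_model (matrix_inv C). invertible (shrink_RB (real CARD('k)) (S_hat (J :: complex^'p^'k)))"
    \<comment> \<open>The Gaussian measure has a Lebesgue density, so a property true Lebesgue
      almost everywhere is true almost surely.\<close>
    unfolding gauss_model_eq using AE_invertible_shrink_RB[OF assms] by (subst AE_density) auto
  then show "AE J in gauss_model (matrix_inv C). invertible (S_RB J)"
    using rao_blackwell_estimator_AE_eq[OF S_RB hermitian_pos_def_matrix_inv[OF C]] by eventually_elim simp
next
  fix S_RB :: "complex^'p^'k \<Rightarrow> complex^'p^'p"
  assume S_RB: "rao_blackwell_estimator S_RB"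
  \<comment> \<open>The inverse serves as the initial estimator itself: it is a function of the data
    through \<open>S_hat\<close>, so conditioning leaves it unchanged.\<close>
  have "cond_exp_given {C. hermitian_pos_def C} (\<lambda>C. gauss_model (matrix_inv C))
      (\<lambda>J. matrix_inv (S_RB J)) S_hat (\<lambda>J. matrix_inv (S_RB J))"
  proof (rule cond_exp_given_of_measurable)
    fix C :: "complex^'p^'p" assume "C \<in> {C. hermitian_pos_def C}"
    then have pd: "hermitian_pos_def (matrix_inv C)" by (simp add: hermitian_pos_def_matrix_inv)
    interpret S_hat_model "gauss_model (matrix_inv C) :: (complex^'p^'k) measure"
        "\<lambda>A. ennreal (cgauss_weight CARD('k) (matrix_inv C) A)"
      by (rule S_hat_model_gauss_model[OF pd])
    let ?M = "gauss_model (matrix_inv C) :: (complex^'p^'k) measure"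
    show "finite_measure_subalgebra ?M (sigma_of ?M S_hat)" by unfold_locales
    show "S_hat \<in> borel_measurable ?M" by simp
    have "S_RB \<in> borel_measurable (sigma_of ?M S_hat)"
      using S_RB pd unfolding rao_blackwell_estimator_def cond_exp_given_def by blast
    then show "(\<lambda>J. matrix_inv (S_RB J)) \<in> borel_measurable (sigma_of ?M S_hat)"
      by (rule measurable_compose[OF _ borel_measurable_matrix_inv])
  qed
  then show "rao_blackwellized_given {C. hermitian_pos_def C} (\<lambda>C. gauss_model (matrix_inv C))
        S_hat (\<lambda>J. matrix_inv (S_RB J))"
    unfolding rao_blackwellized_given_def using sufficient_for_S_hat by blast
qed

end
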